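(* Let $d\ge 1$ and $\varepsilon>0$. Let $F:\mathbb{C}\to\mathbb{C}$ be the homogeneous nonlinearity of degree $1+\frac{2}{d}$ given by $F(0)=0$ and $F(u)=|u|^{1+\frac{2}{d}}\,g(\arg u)$ for $u\ne 0$, where $g(\theta)=\sum_{n\in\mathbb{Z}} g_n e^{in\theta}$. Suppose that $\{g_n\}_n\in \ell^1(\mathbb{Z})$ satisfies $g_0=1$ and $$\mu := g_0-\sum_{n\neq 0}|g_n|>0 .$$ If $f\in L^1_{\mathrm{loc}}(\mathbb{R}^d)$ satisfies $$-\operatorname{Im} f(x)\ \ge\ \begin{cases} |x|^{-d}(\log|x|)^{-\alpha} & \text{if } |x|>R_0,\\ 0 & \text{if } |x|\le R_0,\end{cases}$$ for some $\alpha\in\mathbb{R}$ and $R_0>0$, then there exist $C=C(\alpha,R_0,\mu)>0$ and $\varepsilon_0>0$ such that $$T_{\max}(\varepsilon f)\ \le\ \begin{cases}\exp\left(C\varepsilon^{-\frac{2}{d}}\right) & \text{if } \alpha>1,\\[2pt] \exp\left(C\left(\varepsilon\log \varepsilon^{-1}\right)^{-\frac{2}{d}}\right) & \text{if } \alpha=1,\\[2pt] \exp\left(C\varepsilon^{-\frac{2}{d+2(1-\alpha)}}\right) & \text{if } \alpha<1\end{cases}$$ holds for any $\varepsilon\in(0,\varepsilon_0)$. Here $T_{\max}(\varepsilon f)$ denotes the maximal existence time of weak solutions to $i\partial_t u+\Delta u=F(u)$ with initial data $u(0,x)=\varepsilon f(x)$.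
   Context: The equation is the nonlinear Schrödinger equation $i\partial_t u+\Delta u=F(u)$, $(t,x)\in\mathbb{R}^{1+d}$, where $u=u(t,x)$ is a complex-valued unknown function and $F(\lambda z)=\lambda^{1+\frac{2}{d}}F(z)$ for all $z\in\mathbb{C}$, $\lambda>0$. Equivalently, $F(u)=\sum_{n\in\mathbb{Z}} g_n|u|^{1+\frac{2}{d}-n}u^n$ for $u\neq 0$, with $g_n=\frac{1}{2\pi}\int_0^{2\pi}F(e^{i\theta})e^{-in\theta}\,d\theta$. Weak solution (for $F$ locally uniformly bounded, which holds when $\{g_n\}_n\in\ell^1(\mathbb{Z})$): for $T>0$ and $u_0\in L^1_{\mathrm{loc}}(\mathbb{R}^d)$, a function $u(t,x)\in\mathscr{S}'((-\infty,T)\times\mathbb{R}^d)$ is a weak solution on $[0,T)$ with initial data $u(0,x)=u_0(x)$ if $u\in L^{(d+2)/d}_{\mathrm{loc}}((0,T)\times\mathbb{R}^d)$ and the identity $$\int_{(0,T)\times\mathbb{R}^d}u(t,x)\bigl(-i\partial_t\psi(t,x)+\Delta\psi(t,x)\bigr)\,dx\,dt = i\int_{\mathbb{R}^d}u_0(x)\psi(0,x)\,dx+\int_{(0,T)\times\mathbb{R}^d}F(u(t,x))\psi(t,x)\,dx\,dt$$ holds for any test function $\psi\in C_0^\infty((-\infty,T)\times\mathbb{R}^d)$. Maximal existence time: for $u_0\in L^1_{\mathrm{loc}}(\mathbb{R}^d)$, $$T_{\max}(u_0):=\sup\{T>0 : \text{there exists a weak solution } u \text{ with } u(0)=u_0 \text{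 on } [0,T)\}.$$ *)

theory Defs
  imports "HOL-Analysis.Analysis"
begin

section \<open>Smooth functions, test functions, tempered distributions\<close>

definition dir_deriv ::
  "'e::euclidean_space \<Rightarrow> ('e \<Rightarrow> complex) \<Rightarrow> 'e \<Rightarrow> complex" where
  "dir_deriv v \<phi> z = frechet_derivative \<phi> (at z) v"

fun iter_dir_deriv ::
  "'e::euclidean_space list \<Rightarrow> ('e \<Rightarrow> complex) \<Rightarrow> 'e \<Rightarrow> complex" where
  "iter_dir_deriv [] \<phi> = \<phi>"
| "iter_dir_deriv (v # vs) \<phi> = dir_deriv v (iter_dir_deriv vs \<phi>)"

fun times_cont_diff :: "nat \<Rightarrow> ('e::euclidean_space \<Rightarrow> complex) \<Rightarrow> bool" where
  "times_cont_diff 0 \<phi> \<longleftrightarrow> continuous_on UNIV \<phi>"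
| "times_cont_diff (Suc k) \<phi> \<longleftrightarrow>
     (\<forall>z. \<phi> differentiable (at z)) \<and> (\<forall>v. times_cont_diff k (dir_deriv v \<phi>))"

definition smooth :: "('e::euclidean_space \<Rightarrow> complex) \<Rightarrow> bool" where
  "smooth \<phi> \<longleftrightarrow> (\<forall>k. times_cont_diff k \<phi>)"

text \<open>
  Test functions on an open set \<open>\<Omega>\<close> are represented by their extension by zero to the whole space.
\<close>

definition test_function :: "'e::euclidean_space set \<Rightarrow> ('e \<Rightarrow> complex) \<Rightarrow> bool" where
  "test_function \<Omega> \<phi> \<longleftrightarrow>
     smooth \<phi> \<and> compact (closure {z. \<phi> z \<noteq> 0}) \<and> closure {z. \<phi> z \<noteq> 0} \<subseteq> \<Omega>"

definition schwartz :: "('e::euclidean_space \<Rightarrow> complex) \<Rightarrow> bool" where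
  "schwartz \<phi> \<longleftrightarrow> smooth \<phi> \<and>
     (\<forall>k vs. set vs \<subseteq> Basis \<longrightarrow>
        bounded (range (\<lambda>z. (1 + norm z) ^ k * norm (iter_dir_deriv vs \<phi> z))))"

definition schwartz_norm :: "nat \<Rightarrow> ('e::euclidean_space \<Rightarrow> complex) \<Rightarrow> real" where
  "schwartz_norm N \<phi> =
     (SUP (vs, z) \<in> {vs. set vs \<subseteq> Basis \<and> length vs \<le> N} \<times> UNIV.
        (1 + norm z) ^ N * norm (iter_dir_deriv vs \<phi> z))"

definition tempered_distribution ::
  "(('e::euclidean_space \<Rightarrow> complex) \<Rightarrow> complex) \<Rightarrow> bool" where
  "tempered_distribution V \<longleftrightarrow>
     (\<forall>\<phi> \<psi>. schwartz \<phi> \<longrightarrow> schwartz \<psi> \<longrightarrow> V (\<lambda>z. \<phi> z + \<psi> z) = V \<phi> + V \<psi>) \<and>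
     (\<forall>c \<phi>. schwartz \<phi> \<longrightarrow> V (\<lambda>z. c * \<phi> z) = c * V \<phi>) \<and>
     (\<exists>N C. \<forall>\<phi>. schwartz \<phi> \<longrightarrow> norm (V \<phi>) \<le> C * schwartz_norm N \<phi>)"

text \<open>
  \<open>\<S>'(\<Omega>)\<close> consists of the restrictions to \<open>\<Omega>\<close> of tempered distributions on the whole space.
\<close>

definition tempered_distribution_on ::
  "'e::euclidean_space set \<Rightarrow> (('e \<Rightarrow> complex) \<Rightarrow> complex) \<Rightarrow> bool" where
  "tempered_distribution_on \<Omega> U \<longleftrightarrow>
     (\<exists>V. tempered_distribution V \<and> (\<forall>\<phi>. test_function \<Omega> \<phi> \<longrightarrow> U \<phi> = V \<phi>))"

definition Lp_loc :: "real \<Rightarrow> 'e::euclidean_space set \<Rightarrow> ('e \<Rightarrow> complex) \<Rightarrow> bool" where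
  "Lp_loc p \<Omega> u \<longleftrightarrow> u \<in> borel_measurable (lebesgue_on \<Omega>) \<and>
     (\<forall>K. compact K \<and> K \<subseteq> \<Omega> \<longrightarrow> set_integrable lebesgue K (\<lambda>z. norm (u z) powr p))"

section \<open>The equation\<close>

definition homogeneous_nonlinearity :: "real \<Rightarrow> (int \<Rightarrow> complex) \<Rightarrow> complex \<Rightarrow> complex" where
  "homogeneous_nonlinearity p g z =
     (if z = 0 then 0
      else complex_of_real (norm z powr p) *
             (\<Sum>\<^sub>\<infinity>n. g n * exp (\<i> * of_int n * complex_of_real (Arg z))))"

definition time_deriv ::
  "(real \<times> 'a::euclidean_space \<Rightarrow> complex) \<Rightarrow> real \<times> 'a \<Rightarrow> complex" where
  "time_deriv \<psi> = dir_deriv (1, 0) \<psi>"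

definition space_laplacian ::
  "(real \<times> 'a::euclidean_space \<Rightarrow> complex) \<Rightarrow> real \<times> 'a \<Rightarrow> complex" where
  "space_laplacian \<psi> z = (\<Sum>b\<in>Basis. dir_deriv (0, b) (dir_deriv (0, b) \<psi>) z)"

text \<open>
  Only the values of \<open>u\<close> on \<open>(0,T) \<times> \<real>\<^sup>d\<close> enter. Membership in \<open>\<S>'((-\<infinity>,T) \<times> \<real>\<^sup>d)\<close> is expressed by a
  tempered distribution \<open>U\<close> given by the function \<open>u\<close> on \<open>(0,T) \<times> \<real>\<^sup>d\<close>. The test functions need not
  vanish at \<open>t = 0\<close>, so local integrability in the open set \<open>(0,T) \<times> \<real>\<^sup>d\<close> does not make the space-time
  integrals converge. As the Lebesgue integral of a non-integrable function is \<open>0\<close> here, that the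
  identity makes sense has to be stated separately.
\<close>

definition weak_solution ::
  "(complex \<Rightarrow> complex) \<Rightarrow> ('a::euclidean_space \<Rightarrow> complex) \<Rightarrow> real \<Rightarrow>
   (real \<times> 'a \<Rightarrow> complex) \<Rightarrow> bool" where
  "weak_solution F u0 T u \<longleftrightarrow>
     (\<exists>U. tempered_distribution_on ({..<T} \<times> UNIV) U \<and>
        (\<forall>\<phi>. test_function ({0<..<T} \<times> UNIV) \<phi> \<longrightarrow>
               U \<phi> = (LINT z:{0<..<T} \<times> UNIV|lebesgue. u z * \<phi> z))) \<and>
     Lp_loc ((real DIM('a) + 2) / real DIM('a)) ({0<..<T} \<times> UNIV) u \<and>
     (\<forall>\<psi>. test_function ({..<T} \<times> UNIV) \<psi> \<longrightarrow>
        set_integrable lebesgue ({0<..<T} \<times> UNIV)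
          (\<lambda>z. u z * (- \<i> * time_deriv \<psi> z + space_laplacian \<psi> z)) \<and>
        set_integrable lebesgue ({0<..<T} \<times> UNIV) (\<lambda>z. F (u z) * \<psi> z) \<and>
        (LINT z:{0<..<T} \<times> UNIV|lebesgue.
            u z * (- \<i> * time_deriv \<psi> z + space_laplacian \<psi> z)) =
        \<i> * (LINT x|lebesgue. u0 x * \<psi> (0, x)) +
        (LINT z:{0<..<T} \<times> UNIV|lebesgue. F (u z) * \<psi> z))"

text \<open>
  The supremum is taken in \<open>[0,\<infinity>]\<close>, so it is \<open>0\<close> if there is no weak solution for any \<open>T > 0\<close>.
\<close>

definition T_max :: "(complex \<Rightarrow> complex) \<Rightarrow> ('a::euclidean_space \<Rightarrow> complex) \<Rightarrow> ennreal" where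
  "T_max F u0 = Sup {ennreal T | T. T > 0 \<and> (\<exists>u. weak_solution F u0 T u)}"

end

theory Submission
  imports Defs "HOL-Computational_Algebra.Polynomial"
begin

text \<open>
  The proof is a test function argument with a logarithmic cutoff. Let \<open>\<rho>(t, x) = 1 + t\<^sup>2 + \<bar>x\<bar>\<^sup>4\<close>, let
  \<open>h(s) = exp (- 1 / s)\<close> for \<open>s > 0\<close> and \<open>0\<close> otherwise, and test a weak solution on \<open>[0, T)\<close> with
  \<open>\<psi> = h (1 - ln \<rho> / L)\<close>, where \<open>L = 2 ln T\<close>. In the real part of the weak identity the data
  contribute \<open>\<epsilon> \<integral> - Im f \<cdot> \<psi>(0, \<cdot>) \<ge> 0\<close>, and the nonlinearity contributes at least \<open>\<mu> \<integral> \<bar>u\<bar>\<^sup>p \<psi>\<close> with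
  \<open>p = 1 + 2 / d\<close>, because the mode \<open>g\<^sub>0 = 1\<close> dominates the others
  (\<open>Re_homogeneous_nonlinearity_ge\<close>).

  The derivatives of \<open>\<psi>\<close> that occur are at most of order \<open>\<psi> powr (1 / p) / (L * sqrt \<rho>)\<close>: the logarithm gives
  the factor \<open>1 / L\<close>, and the flatness of \<open>h\<close> allows for the power of \<open>\<psi>\<close>. By Young's inequality the
  linear term is absorbed into the nonlinear one, up to \<open>(L * sqrt \<rho>) powr (- (1 + d / 2))\<close> on the
  support of \<open>\<psi>\<close> (\<open>weak_integrand_bound\<close>). The degree \<open>p\<close> is critical for the scaling: every layer
  \<open>exp k \<le> \<rho> < exp (k + 1)\<close> contributes equally to the integral of \<open>\<rho> powr (- (d + 2) / 4)\<close>, which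
  therefore is of order \<open>L\<close>. Altogether the data term is at most a constant times
  \<open>L powr (- (d / 2))\<close> (\<open>weak_solution_data_bound\<close>).

  On the other hand, \<open>\<psi>(0, \<cdot>) \<ge> exp (-2)\<close> where \<open>1 + \<bar>x\<bar>\<^sup>4 \<le> exp (L / 2)\<close>. Summing over
  exponential shells \<open>\<bar>x\<bar> \<sim> exp j\<close> bounds the data term below by \<open>\<epsilon>\<close> times \<open>\<Sum> j powr (- \<alpha>)\<close>, the sum
  extending to an index of order \<open>L\<close> (\<open>data_integral_ge_sum\<close>). This sum is of order \<open>1\<close>, \<open>ln L\<close> or
  \<open>L powr (1 - \<alpha>)\<close> if \<open>\<alpha> > 1\<close>, \<open>\<alpha> = 1\<close> or \<open>\<alpha> < 1\<close>. The three resulting inequalities for \<open>L\<close>, solved in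
  \<open>le_lifespan_exponent\<close>, are the three bounds for \<open>ln T\<close>.
\<close>

section \<open>Calculus of smooth functions\<close>

lemma dir_deriv_eq:
  assumes "(\<phi> has_derivative D) (at z)"
  shows "dir_deriv v \<phi> z = D v"
  using frechet_derivative_at[OF assms] by (simp add: dir_deriv_def)

lemma has_derivative_dir_deriv:
  assumes "\<phi> differentiable (at z)"
  shows "(\<phi> has_derivative (\<lambda>v. dir_deriv v \<phi> z)) (at z)"
  using assms by (simp add: dir_deriv_def frechet_derivative_works[symmetric])

text \<open>
  The recursion in \<open>times_cont_diff\<close> does not contain the lower orders explicitly; they are recovered
  from differentiability implying continuity.
\<close>

lemma times_cont_diff_Suc_D: "times_cont_diff (Suc k) \<phi> \<Longrightarrow> times_cont_diff k \<phi>"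
proof (induction k arbitrary: \<phi>)
  case 0
  then show ?case
    by (auto intro!: continuous_at_imp_continuous_on differentiable_imp_continuous_within)
next
  case (Suc k)
  then show ?case by simp
qed

lemma times_cont_diff_const: "times_cont_diff k (\<lambda>z. c)"
proof (induction k arbitrary: c)
  case (Suc k)
  have "dir_deriv v (\<lambda>z. c) = (\<lambda>z::'a. 0)" for v
    by (rule ext, rule dir_deriv_eq) (rule has_derivative_const)
  then show ?case using Suc[of 0] by simp
qed simp

lemma times_cont_diff_bounded_linear:
  assumes "bounded_linear f" shows "times_cont_diff k f"
proof (cases k)
  case 0
  then show ?thesis using assms by (simp add: linear_continuous_on)
next
  case (Suc j)
  have D: "(f has_derivative f) (at z)" for z
    using assms by (rule bounded_linear_imp_has_derivative)
  have "dir_deriv v f = (\<lambda>z. f v)" for v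
    by (rule ext, rule dir_deriv_eq[OF D])
  then show ?thesis using Suc D by (auto simp: times_cont_diff_const differentiable_def)
qed

lemma times_cont_diff_add:
  assumes "times_cont_diff k \<phi>" "times_cont_diff k \<psi>"
  shows "times_cont_diff k (\<lambda>z. \<phi> z + \<psi> z)"
  using assms
proof (induction k arbitrary: \<phi> \<psi>)
  case 0
  then show ?case by (auto intro: continuous_intros)
next
  case (Suc k)
  have "dir_deriv v (\<lambda>z. \<phi> z + \<psi> z) = (\<lambda>z. dir_deriv v \<phi> z + dir_deriv v \<psi> z)" for v
    using Suc.prems
    by (intro ext dir_deriv_eq has_derivative_add has_derivative_dir_deriv) auto
  then show ?case using Suc by (auto intro: differentiable_add)
qed

lemma times_cont_diff_mult:
  assumes "times_cont_diff k \<phi>" "times_cont_diff k \<psi>"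
  shows "times_cont_diff k (\<lambda>z. \<phi> z * \<psi> z)"
  using assms
proof (induction k arbitrary: \<phi> \<psi>)
  case 0
  then show ?case by (auto intro: continuous_intros)
next
  case (Suc k)
  have "dir_deriv v (\<lambda>z. \<phi> z * \<psi> z) = (\<lambda>z. \<phi> z * dir_deriv v \<psi> z + dir_deriv v \<phi> z * \<psi> z)" for v
    using Suc.prems
    by (intro ext dir_deriv_eq has_derivative_mult has_derivative_dir_deriv) auto
  then show ?case
    using Suc times_cont_diff_Suc_D[OF Suc.prems(1)] times_cont_diff_Suc_D[OF Suc.prems(2)]
    by (auto intro!: times_cont_diff_add Suc.IH differentiable_mult)
qed

text \<open>
  The outer function comes with the whole sequence \<open>H\<close> of its derivatives, so that the induction on the
  order stays inside one family: the chain rule turns \<open>H n\<close> into \<open>H (Suc n)\<close> times a derivative of the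
  inner function, and the product rule does the rest. It is enough that \<open>H\<close> is smooth on a set that
  contains the range of the inner function, which admits the logarithm.
\<close>

lemma times_cont_diff_compose:
  fixes q :: "'e::euclidean_space \<Rightarrow> real" and H :: "nat \<Rightarrow> real \<Rightarrow> real"
  assumes H: "\<And>n y. y \<in> S \<Longrightarrow> (H n has_real_derivative H (Suc n) y) (at y)"
    and q: "times_cont_diff k (\<lambda>z. complex_of_real (q z))" and S: "\<And>z. q z \<in> S"
  shows "times_cont_diff k (\<lambda>z. complex_of_real (H n (q z)))"
  using q
proof (induction k arbitrary: n)
  case 0
  have "continuous_on UNIV (\<lambda>z. Re (complex_of_real (q z)))"
    using 0 by (intro continuous_intros) auto
  then have "continuous_on UNIV q" by simp
  moreover have "continuous_on S (H n)"
    using H by (intro continuous_at_imp_continuous_on) (auto intro: DERIV_isCont)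
  ultimately have "continuous_on UNIV (\<lambda>z. H n (q z))"
    using continuous_on_compose2[of S "H n" UNIV q] S by blast
  then show ?case by (auto intro: continuous_intros)
next
  case (Suc k)
  let ?q = "\<lambda>z. complex_of_real (q z)"
  have dq: "(?q has_derivative (\<lambda>v. dir_deriv v ?q z)) (at z)" for z
    using Suc.prems by (intro has_derivative_dir_deriv) auto
  have dqR: "(q has_derivative (\<lambda>v. Re (dir_deriv v ?q z))) (at z)" for z
    using bounded_linear.has_derivative[OF bounded_linear_Re dq[of z]] by simp
  have im: "Im (dir_deriv v ?q z) = 0" for v z
  proof -
    have "((\<lambda>z. Im (?q z)) has_derivative (\<lambda>v. Im (dir_deriv v ?q z))) (at z)"
      by (rule bounded_linear.has_derivative[OF bounded_linear_Im dq])
    then have "((\<lambda>z. 0::real) has_derivative (\<lambda>v. Im (dir_deriv v ?q z))) (at z)" by simp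
    from has_derivative_unique[OF this has_derivative_const] show ?thesis by metis
  qed
  have D: "((\<lambda>z. complex_of_real (H n (q z))) has_derivative
      (\<lambda>v. complex_of_real (H (Suc n) (q z)) * dir_deriv v ?q z)) (at z)" for z
  proof -
    have "((\<lambda>z. H n (q z)) has_derivative (\<lambda>v. H (Suc n) (q z) * Re (dir_deriv v ?q z))) (at z)"
      using has_derivative_compose[OF dqR H[OF S, unfolded has_field_derivative_def]] by simp
    from bounded_linear.has_derivative[OF bounded_linear_of_real this]
    show ?thesis
      by (rule has_derivative_eq_rhs) (auto simp: complex_eq_iff im)
  qed
  have "dir_deriv v (\<lambda>z. complex_of_real (H n (q z))) =
      (\<lambda>z. complex_of_real (H (Suc n) (q z)) * dir_deriv v ?q z)" for v
    by (intro ext dir_deriv_eq[OF D])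
  then show ?case
    using D Suc.IH[OF times_cont_diff_Suc_D[OF Suc.prems]] Suc.prems
    by (auto simp: differentiable_def intro!: times_cont_diff_mult)
qed

section \<open>A flat smooth profile\<close>

text \<open>
  Every derivative of \<open>exp (- 1 / s)\<close>, extended by zero to \<open>s \<le> 0\<close>, is a polynomial in \<open>1 / s\<close> times the
  same exponential. The polynomial is kept as a parameter, since this family is closed under
  differentiation.
\<close>

definition flat :: "real poly \<Rightarrow> real \<Rightarrow> real" where
  "flat P s = (if s > 0 then poly P (1 / s) * exp (- (1 / s)) else 0)"

text \<open>
  Each degree of the polynomial is paid for with half of the exponential decay that is left, through
  \<open>y * exp (- \<delta> * y / 2) \<le> 2 / \<delta>\<close>; this is why the rate is generalised in the induction.
\<close>

lemma poly_exp_bounded: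
  assumes "\<delta> > 0"
  shows "\<exists>C\<ge>0. \<forall>y\<ge>0. \<bar>poly P y\<bar> * exp (- (\<delta> * y)) \<le> (C::real)"
  using assms
proof (induction P arbitrary: \<delta>)
  case 0
  then show ?case by auto
next
  case (pCons a P)
  obtain C where C: "C \<ge> 0" "\<And>y. y \<ge> 0 \<Longrightarrow> \<bar>poly P y\<bar> * exp (- (\<delta>/2 * y)) \<le> C"
    using pCons.IH[of "\<delta>/2"] pCons.prems by auto
  have "\<bar>poly (pCons a P) y\<bar> * exp (- (\<delta> * y)) \<le> \<bar>a\<bar> + 2 / \<delta> * C" if y: "y \<ge> 0" for y
  proof -
    have e: "exp (- (\<delta> * y)) = exp (- (\<delta>/2 * y)) * exp (- (\<delta>/2 * y))"
      by (simp flip: exp_add)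
    have "\<delta>/2 * y \<le> exp (\<delta>/2 * y)" using exp_ge_add_one_self[of "\<delta>/2 * y"] by linarith
    then have "\<delta>/2 * y * exp (- (\<delta>/2 * y)) \<le> 1" by (simp add: exp_minus field_simps)
    then have 1: "y * exp (- (\<delta>/2 * y)) \<le> 2 / \<delta>" using pCons.prems by (simp add: field_simps)
    have "\<bar>poly (pCons a P) y\<bar> * exp (- (\<delta> * y)) \<le> (\<bar>a\<bar> + y * \<bar>poly P y\<bar>) * exp (- (\<delta> * y))"
      using y abs_triangle_ineq[of a "y * poly P y"] by (intro mult_right_mono) (auto simp: abs_mult)
    also have "\<dots> = \<bar>a\<bar> * exp (- (\<delta> * y)) + (y * exp (- (\<delta>/2 * y))) * (\<bar>poly P y\<bar> * exp (- (\<delta>/2 * y)))"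
      by (simp add: e algebra_simps)
    also have "\<dots> \<le> \<bar>a\<bar> * 1 + 2 / \<delta> * C"
      using y C pCons.prems 1 by (intro add_mono mult_mono) auto
    finally show ?thesis by simp
  qed
  then show ?case using C(1) pCons.prems by (intro exI[of _ "\<bar>a\<bar> + 2 / \<delta> * C"]) auto
qed

text \<open>
  Gives differentiability at the origin, the one point that the usual rules do not cover.
\<close>

lemma flat_quadratic_bound: "\<exists>C\<ge>0. \<forall>s. \<bar>flat P s\<bar> \<le> C * s\<^sup>2"
proof -
  obtain C where C: "C \<ge> 0" "\<And>y. y \<ge> 0 \<Longrightarrow> \<bar>poly (monom 1 2 * P) y\<bar> * exp (- (1 * y)) \<le> C"
    using poly_exp_bounded[of 1 "monom 1 2 * P"] by auto
  have "\<bar>flat P s\<bar> \<le> C * s\<^sup>2" for s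
  proof (cases "s > 0")
    case True
    have "\<bar>flat P s\<bar> = (\<bar>poly (monom 1 2 * P) (1/s)\<bar> * exp (- (1 * (1/s)))) * s\<^sup>2"
      using True by (simp add: flat_def abs_mult poly_monom field_simps)
    also have "\<dots> \<le> C * s\<^sup>2" using C(2)[of "1/s"] True by (intro mult_right_mono) auto
    finally show ?thesis .
  qed (use C in \<open>auto simp: flat_def\<close>)
  then show ?thesis using C(1) by auto
qed

lemma flat_has_derivative:
  "(flat P has_real_derivative flat (monom 1 2 * (P - pderiv P)) s) (at s)"
proof -
  consider "s > 0" | "s < 0" | "s = 0" by linarith
  then show ?thesis
  proof cases
    case 1
    have "((\<lambda>s. poly P (1 / s) * exp (- (1 / s))) has_real_derivative
        flat (monom 1 2 * (P - pderiv P)) s) (at s)"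
      using 1
      by (auto intro!: derivative_eq_intros DERIV_chain2[OF poly_DERIV]
          simp: flat_def poly_monom field_simps power2_eq_square)
    moreover have "eventually (\<lambda>s. s \<in> {0<..}) (nhds s)"
      using 1 by (intro eventually_nhds_in_open) auto
    then have "eventually (\<lambda>s. flat P s = poly P (1 / s) * exp (- (1 / s))) (nhds s)"
      by eventually_elim (simp add: flat_def)
    ultimately show ?thesis by (subst DERIV_cong_ev[OF refl _ refl])
  next
    case 2
    have "eventually (\<lambda>s. s \<in> {..<0}) (nhds s)"
      using 2 by (intro eventually_nhds_in_open) auto
    then have "eventually (\<lambda>s. flat P s = 0) (nhds s)"
      by eventually_elim (simp add: flat_def)
    moreover have "((\<lambda>s. 0) has_real_derivative flat (monom 1 2 * (P - pderiv P)) s) (at s)"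
      using 2 by (simp add: flat_def)
    ultimately show ?thesis by (subst DERIV_cong_ev[OF refl _ refl])
  next
    case 3
    obtain C where C: "C \<ge> 0" "\<And>s. \<bar>flat P s\<bar> \<le> C * s\<^sup>2" using flat_quadratic_bound by blast
    have "((\<lambda>s. C * \<bar>s\<bar>) \<longlongrightarrow> 0) (at 0)" by (auto intro!: tendsto_eq_intros)
    then have "((\<lambda>h. flat P h / h) \<longlongrightarrow> 0) (at 0)"
    proof (rule Lim_null_comparison[rotated])
      show "eventually (\<lambda>h. norm (flat P h / h) \<le> C * \<bar>h\<bar>) (at 0)"
      proof (rule eventually_at_filter[THEN iffD2], rule always_eventually, intro allI impI)
        fix h :: real assume "h \<noteq> 0"
        then show "norm (flat P h / h) \<le> C * \<bar>h\<bar>"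
          using C(2)[of h] by (simp add: field_simps power2_eq_square)
      qed
    qed
    then show ?thesis using 3 by (simp add: DERIV_def flat_def)
  qed
qed

text \<open>
  This is what makes the exponential profile suitable for the test function method: a derivative costs
  only negative powers of \<open>s\<close>, which any fraction \<open>exp (- (1 - \<theta>) / s)\<close> of the profile absorbs. With
  \<open>\<theta>\<close> the reciprocal of the degree of the nonlinearity, Young's inequality can then compare the linear
  term with the nonlinear one, although the cutoff vanishes at the edge of its support.
\<close>

lemma flat_le_flat_powr:
  assumes "\<theta> < 1"
  shows "\<exists>C\<ge>0. \<forall>s. \<bar>flat P s\<bar> \<le> C * flat 1 s powr \<theta>"
proof -
  obtain C where C: "C \<ge> 0" "\<And>y. y \<ge> 0 \<Longrightarrow> \<bar>poly P y\<bar> * exp (- ((1 - \<theta>) * y)) \<le> C"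
    using poly_exp_bounded[of "1 - \<theta>" P] assms by auto
  have "\<bar>flat P s\<bar> \<le> C * flat 1 s powr \<theta>" for s
  proof (cases "s > 0")
    case True
    have "\<bar>flat P s\<bar> = (\<bar>poly P (1/s)\<bar> * exp (- ((1 - \<theta>) * (1/s)))) * flat 1 s powr \<theta>"
      using True by (simp add: flat_def abs_mult exp_powr_real field_simps flip: exp_add)
    also have "\<dots> \<le> C * flat 1 s powr \<theta>"
      using C(2)[of "1/s"] True by (intro mult_right_mono) auto
    finally show ?thesis .
  qed (use C in \<open>auto simp: flat_def\<close>)
  then show ?thesis using C(1) by auto
qed

text \<open>
  The polynomial that belongs to the derivative of order \<open>n\<close> of \<open>exp (- 1 / s)\<close>.
\<close>

definition flat_poly :: "nat \<Rightarrow> real poly" where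
  "flat_poly n = ((\<lambda>P. monom 1 2 * (P - pderiv P)) ^^ n) 1"

lemma flat_poly_has_derivative:
  "(flat (flat_poly n) has_real_derivative flat (flat_poly (Suc n)) s) (at s)"
  using flat_has_derivative[of "flat_poly n" s] by (simp add: flat_poly_def)

lemma flat_one_nonneg: "flat 1 s \<ge> 0"
  by (simp add: flat_def)

lemma flat_one_le_one: "flat 1 s \<le> 1"
  by (simp add: flat_def)

lemma flat_one_ge: "s \<ge> 1/2 \<Longrightarrow> flat 1 s \<ge> exp (-2)"
  by (auto simp: flat_def field_simps)

section \<open>The logarithmic parabolic cutoff\<close>

text \<open>
  Comparable to \<open>(1 + \<bar>t\<bar> + \<bar>x\<bar>\<^sup>2)\<^sup>2\<close>, hence adapted to the scaling under which \<open>i \<partial>\<^sub>t + \<Delta>\<close> is homogeneous. Being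
  a polynomial that is at least \<open>1\<close> on all of space-time, it has a smooth logarithm, and its sublevel
  sets are compact without a separate cutoff at negative times.
\<close>

definition parabolic_size :: "real \<times> 'a::euclidean_space \<Rightarrow> real" where
  "parabolic_size z = 1 + (fst z)\<^sup>2 + (snd z \<bullet> snd z)\<^sup>2"

text \<open>
  For \<open>L > 0\<close>, positive exactly where \<open>parabolic_size z < exp L\<close>, and at least \<open>1/2\<close> where the logarithm of the size
  is at most \<open>L / 2\<close>.
\<close>

definition log_level :: "real \<Rightarrow> real \<times> 'a::euclidean_space \<Rightarrow> real" where
  "log_level L z = 1 - ln (parabolic_size z) / L"

definition log_cutoff :: "real \<Rightarrow> real \<times> 'a::euclidean_space \<Rightarrow> real" where
  "log_cutoff L z = flat 1 (log_level L z)"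

definition parabolic_size_deriv :: "real \<times> 'a::euclidean_space \<Rightarrow> real \<times> 'a \<Rightarrow> real" where
  "parabolic_size_deriv v z = 2 * fst z * fst v + 4 * (snd z \<bullet> snd z) * (snd z \<bullet> snd v)"

lemma parabolic_size_ge_one: "parabolic_size z \<ge> 1"
  by (simp add: parabolic_size_def)

lemma parabolic_size_pos: "parabolic_size z > 0"
  using parabolic_size_ge_one[of z] by linarith

lemma parabolic_size_has_derivative: "(parabolic_size has_derivative (\<lambda>v. parabolic_size_deriv v z)) (at z)"
  unfolding parabolic_size_def[abs_def] parabolic_size_deriv_def
  by (auto intro!: derivative_eq_intros simp: algebra_simps inner_commute)

lemma log_level_has_derivative:
  "(log_level L has_derivative (\<lambda>v. - parabolic_size_deriv v z / (L * parabolic_size z))) (at z)"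
proof (cases "L = 0")
  case False
  then show ?thesis
    unfolding log_level_def[abs_def] using parabolic_size_pos[of z]
    by (auto intro!: derivative_eq_intros parabolic_size_has_derivative simp: field_simps)
qed (simp add: log_level_def[abs_def])

lemma flat_log_level_has_derivative:
  "((\<lambda>z. flat (flat_poly n) (log_level L z)) has_derivative
    (\<lambda>v. flat (flat_poly (Suc n)) (log_level L z) * (- parabolic_size_deriv v z / (L * parabolic_size z)))) (at z)"
  using has_derivative_compose[OF log_level_has_derivative
      flat_poly_has_derivative[unfolded has_field_derivative_def]] by simp

lemma times_cont_diff_sum:
  assumes "finite I" "\<And>i. i \<in> I \<Longrightarrow> times_cont_diff k (\<phi> i)"
  shows "times_cont_diff k (\<lambda>z. \<Sum>i\<in>I. \<phi> i z)"
  using assms by (induction I rule: finite_induct) (auto intro: times_cont_diff_const times_cont_diff_add)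

lemma times_cont_diff_parabolic_size:
  "times_cont_diff k (\<lambda>z::real \<times> 'a::euclidean_space. complex_of_real (parabolic_size z))"
proof -
  have t: "times_cont_diff k (\<lambda>z::real \<times> 'a. complex_of_real (fst z))"
    by (intro times_cont_diff_bounded_linear bounded_linear_compose[OF bounded_linear_of_real]
        bounded_linear_fst)
  have x: "times_cont_diff k (\<lambda>z::real \<times> 'a. complex_of_real (snd z \<bullet> b))" for b
    by (intro times_cont_diff_bounded_linear bounded_linear_compose[OF bounded_linear_of_real]
        bounded_linear_compose[OF bounded_linear_inner_left] bounded_linear_snd)
  have xx: "times_cont_diff k (\<lambda>z::real \<times> 'a.
      \<Sum>b\<in>Basis. complex_of_real (snd z \<bullet> b) * complex_of_real (snd z \<bullet> b))"
    by (intro times_cont_diff_sum times_cont_diff_mult x) auto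
  have "times_cont_diff k (\<lambda>z::real \<times> 'a.
      1 + complex_of_real (fst z) * complex_of_real (fst z) +
      (\<Sum>b\<in>Basis. complex_of_real (snd z \<bullet> b) * complex_of_real (snd z \<bullet> b)) *
      (\<Sum>b\<in>Basis. complex_of_real (snd z \<bullet> b) * complex_of_real (snd z \<bullet> b)))"
    by (intro times_cont_diff_add times_cont_diff_mult times_cont_diff_const t xx)
  moreover have "complex_of_real (parabolic_size z) =
      1 + complex_of_real (fst z) * complex_of_real (fst z) +
      (\<Sum>b\<in>Basis. complex_of_real (snd z \<bullet> b) * complex_of_real (snd z \<bullet> b)) *
      (\<Sum>b\<in>Basis. complex_of_real (snd z \<bullet> b) * complex_of_real (snd z \<bullet> b))" for z :: "real \<times> 'a"
    by (simp add: parabolic_size_def power2_eq_square euclidean_inner[of "snd z" "snd z"])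
  ultimately show ?thesis by simp
qed

fun ln_deriv :: "nat \<Rightarrow> real \<Rightarrow> real" where
  "ln_deriv 0 y = ln y"
| "ln_deriv (Suc n) y = (-1) ^ n * fact n / y ^ Suc n"

lemma ln_deriv_has_derivative:
  assumes "y > 0"
  shows "(ln_deriv n has_real_derivative ln_deriv (Suc n) y) (at y)"
proof (cases n)
  case 0
  have "ln_deriv 0 = ln" by auto
  then show ?thesis using 0 assms DERIV_ln[of y] by (simp add: divide_inverse)
next
  case (Suc m)
  have "ln_deriv (Suc m) = (\<lambda>y. (-1) ^ m * fact m / y ^ Suc m)" by auto
  then show ?thesis using Suc assms
    by (auto intro!: derivative_eq_intros simp del: power_Suc)
       (simp add: field_simps)
qed

lemma smooth_log_cutoff:
  "smooth (\<lambda>z::real \<times> 'a::euclidean_space. complex_of_real (log_cutoff L z))"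
  unfolding smooth_def
proof
  fix k
  have "times_cont_diff k (\<lambda>z::real \<times> 'a. complex_of_real (ln_deriv 0 (parabolic_size z)))"
    by (rule times_cont_diff_compose[where S = "{0<..}"])
       (auto intro: ln_deriv_has_derivative times_cont_diff_parabolic_size parabolic_size_pos simp del: ln_deriv.simps)
  then have "times_cont_diff k
      (\<lambda>z::real \<times> 'a. 1 + complex_of_real (- 1 / L) * complex_of_real (ln (parabolic_size z)))"
    by (intro times_cont_diff_add times_cont_diff_mult times_cont_diff_const) auto
  then have "times_cont_diff k (\<lambda>z::real \<times> 'a. complex_of_real (log_level L z))"
    by (simp add: log_level_def)
  then have "times_cont_diff k
      (\<lambda>z::real \<times> 'a. complex_of_real (flat (flat_poly 0) (log_level L z)))"
    by (intro times_cont_diff_compose[where S = UNIV and H = "\<lambda>n. flat (flat_poly n)"]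
        flat_poly_has_derivative) auto
  then show "times_cont_diff k (\<lambda>z::real \<times> 'a. complex_of_real (log_cutoff L z))"
    by (simp add: log_cutoff_def flat_poly_def)
qed

lemma flat_log_level_eq_0:
  assumes "L > 0" "parabolic_size z \<ge> exp L"
  shows "flat P (log_level L z) = 0"
proof -
  have "ln (parabolic_size z) \<ge> L" using assms by (simp add: ln_ge_iff parabolic_size_pos)
  then show ?thesis using assms by (simp add: log_level_def flat_def)
qed

lemma parabolic_size_bounds:
  assumes "parabolic_size z \<le> r"
  shows "norm (fst z) < sqrt r" "norm (snd z) \<le> sqrt (sqrt r)"
proof -
  have "(fst z)\<^sup>2 < r" using assms zero_le_power2[of "snd z \<bullet> snd z"] unfolding parabolic_size_def by linarith
  then have "sqrt ((fst z)\<^sup>2) < sqrt r" by (rule real_sqrt_less_mono)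
  then show "norm (fst z) < sqrt r" by simp
  have "(snd z \<bullet> snd z)\<^sup>2 \<le> r" using assms zero_le_power2[of "fst z"] unfolding parabolic_size_def by linarith
  then have "snd z \<bullet> snd z \<le> sqrt r" by (simp add: real_le_rsqrt)
  then show "norm (snd z) \<le> sqrt (sqrt r)" by (simp add: norm_eq_sqrt_inner)
qed

text \<open>
  On the support \<open>t\<^sup>2 < exp L\<close>, so the choice \<open>L = 2 ln T\<close> keeps all times below \<open>T\<close>.
\<close>

lemma test_function_log_cutoff:
  assumes L: "L > 0" and T: "exp (L / 2) \<le> T"
  shows "test_function ({..<T} \<times> UNIV)
    (\<lambda>z::real \<times> 'a::euclidean_space. complex_of_real (log_cutoff L z))"
proof -
  let ?K = "{z::real \<times> 'a. parabolic_size z \<le> exp L}"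
  let ?supp = "{z::real \<times> 'a. complex_of_real (log_cutoff L z) \<noteq> 0}"
  have sqrt: "sqrt (exp L) = exp (L / 2)"
    by (rule real_sqrt_unique) (auto simp flip: exp_of_nat_mult)
  have sub: "?supp \<subseteq> ?K"
    using flat_log_level_eq_0[OF L, of _ 1] by (force simp: log_cutoff_def)
  have "continuous_on UNIV (parabolic_size :: real \<times> 'a \<Rightarrow> real)"
    by (intro has_derivative_continuous_on[where f' = "\<lambda>z v. parabolic_size_deriv v z"])
       (simp add: parabolic_size_has_derivative)
  then have cl: "closed ?K"
    by (intro closed_Collect_le) auto
  have "?K \<subseteq> cball 0 (exp (L/2)) \<times> cball 0 (sqrt (exp (L/2)))"
    using parabolic_size_bounds[of _ "exp L", unfolded sqrt] by (force simp: dist_norm)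
  then have "bounded ?K"
    by (rule bounded_subset[rotated]) (intro bounded_Times bounded_cball)
  with cl have K: "compact ?K" by (simp add: compact_eq_bounded_closed)
  have c: "closure ?supp \<subseteq> ?K" using sub cl by (rule closure_minimal)
  have "?K \<subseteq> {..<T} \<times> UNIV"
    using parabolic_size_bounds(1)[of _ "exp L", unfolded sqrt] T by (force simp: abs_less_iff)
  moreover have "compact (closure ?supp)"
    using c K by (metis closed_closure compact_Int_closed inf.absorb_iff2)
  ultimately show ?thesis
    unfolding test_function_def using smooth_log_cutoff c by blast
qed

lemma dir_deriv_of_real:
  assumes "(\<phi> has_derivative D) (at z)"
  shows "dir_deriv v (\<lambda>z. complex_of_real (\<phi> z)) z = complex_of_real (D v)"
  by (rule dir_deriv_eq[OF bounded_linear.has_derivative[OF bounded_linear_of_real assms]])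

lemma dir_deriv_log_cutoff:
  "dir_deriv v (\<lambda>z. complex_of_real (log_cutoff L z)) =
    (\<lambda>z. complex_of_real (flat (flat_poly 1) (log_level L z) * (- parabolic_size_deriv v z / (L * parabolic_size z))))"
  using dir_deriv_of_real[OF flat_log_level_has_derivative[of 0 L]]
  by (intro ext) (simp add: log_cutoff_def flat_poly_def)

lemma dir_deriv2_log_cutoff:
  fixes b :: "'a::euclidean_space"
  assumes b: "b \<in> Basis"
  shows "dir_deriv (0, b) (dir_deriv (0, b) (\<lambda>z. complex_of_real (log_cutoff L z))) z =
    complex_of_real
     (flat (flat_poly 2) (log_level L z) * (parabolic_size_deriv (0, b) z / (L * parabolic_size z))\<^sup>2 +
      flat (flat_poly 1) (log_level L z) *
        ((parabolic_size_deriv (0, b) z)\<^sup>2 / (L * (parabolic_size z)\<^sup>2) -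
         (8 * (snd z \<bullet> b)\<^sup>2 + 4 * (snd z \<bullet> snd z)) / (L * parabolic_size z)))"
proof -
  have D: "((\<lambda>z. parabolic_size_deriv (0, b) z) has_derivative
     (\<lambda>v. 8 * (snd z \<bullet> snd v) * (snd z \<bullet> b) + 4 * (snd z \<bullet> snd z) * (snd v \<bullet> b))) (at z)"
    unfolding parabolic_size_deriv_def[abs_def]
    by (auto intro!: derivative_eq_intros simp: algebra_simps inner_commute)
  have "((\<lambda>z. - parabolic_size_deriv (0, b) z / (L * parabolic_size z)) has_derivative
     (\<lambda>v. parabolic_size_deriv (0, b) z * parabolic_size_deriv v z / (L * (parabolic_size z)\<^sup>2) -
       (8 * (snd z \<bullet> snd v) * (snd z \<bullet> b) + 4 * (snd z \<bullet> snd z) * (snd v \<bullet> b)) / (L * parabolic_size z))) (at z)"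
  proof (cases "L = 0")
    case False
    then show ?thesis using parabolic_size_pos[of z]
      by (auto intro!: derivative_eq_intros D parabolic_size_has_derivative
          simp: field_simps power2_eq_square)
  qed simp
  from dir_deriv_of_real[OF has_derivative_mult[OF flat_log_level_has_derivative[of 1 L z] this],
      of "(0, b)"]
  show ?thesis
    unfolding dir_deriv_log_cutoff using b
    by (simp add: power2_eq_square inner_same_Basis mult.assoc numeral_2_eq_2 add.commute)
qed

text \<open>
  Writing \<open>w\<close> for the square root of the parabolic size, \<open>\<bar>t\<bar> \<le> w\<close> and \<open>\<bar>x\<bar>\<^sup>2 \<le> w\<close>, so a time derivative or
  two space derivatives of the logarithm of the size are at most of order \<open>1 / w\<close>. The factor \<open>1 / L\<close> from the
  slope of the level function is the gain of a logarithmic cutoff over one that is rescaled linearly.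
\<close>

lemma norm_dual_operator_log_cutoff:
  fixes z :: "real \<times> 'a::euclidean_space"
  assumes L: "L \<ge> 1"
  defines "\<psi> \<equiv> (\<lambda>z::real \<times> 'a. complex_of_real (log_cutoff L z))"
  shows "norm (- \<i> * time_deriv \<psi> z + space_laplacian \<psi> z) \<le>
    30 * DIM('a) * (\<bar>flat (flat_poly 1) (log_level L z)\<bar> + \<bar>flat (flat_poly 2) (log_level L z)\<bar>) /
      (L * sqrt (parabolic_size z))"
proof -
  define w where "w = sqrt (parabolic_size z)"
  define f1 where "f1 = flat (flat_poly 1) (log_level L z)"
  define f2 where "f2 = flat (flat_poly 2) (log_level L z)"
  define X where "X = snd z \<bullet> snd z"
  have w: "w \<ge> 1" "parabolic_size z = w\<^sup>2" using parabolic_size_ge_one[of z] by (auto simp: w_def)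
  have X: "0 \<le> X" "X \<le> w"
    unfolding X_def w_def by (auto intro!: real_le_rsqrt simp: parabolic_size_def)
  have t: "\<bar>fst z\<bar> \<le> w"
    unfolding w_def by (rule real_le_rsqrt) (simp add: parabolic_size_def)
  have time: "norm (time_deriv \<psi> z) \<le> 2 * \<bar>f1\<bar> / (L * w)"
  proof -
    have "norm (time_deriv \<psi> z) = \<bar>f1\<bar> * (2 * \<bar>fst z\<bar>) / (L * w\<^sup>2)"
      using L w unfolding time_deriv_def \<psi>_def dir_deriv_log_cutoff norm_of_real
      by (simp add: f1_def parabolic_size_deriv_def abs_mult)
    also have "\<dots> \<le> \<bar>f1\<bar> * (2 * w) / (L * w\<^sup>2)"
      using t L w by (intro divide_right_mono mult_left_mono) auto
    also have "\<dots> = 2 * \<bar>f1\<bar> / (L * w)" using L w by (simp add: power2_eq_square)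
    finally show ?thesis .
  qed
  have space: "norm (dir_deriv (0, b) (dir_deriv (0, b) \<psi>) z) \<le> 28 * (\<bar>f1\<bar> + \<bar>f2\<bar>) / (L * w)"
    if b: "b \<in> Basis" for b
  proof -
    define G where "G = parabolic_size_deriv (0, b) z"
    have xb: "(snd z \<bullet> b)\<^sup>2 \<le> X"
    proof -
      have "\<bar>snd z \<bullet> b\<bar> \<le> norm (snd z)" using b by (rule Basis_le_norm)
      then have "(snd z \<bullet> b)\<^sup>2 \<le> (norm (snd z))\<^sup>2" by (metis abs_ge_zero power2_abs power_mono)
      then show ?thesis by (simp add: X_def power2_norm_eq_inner)
    qed
    have "G\<^sup>2 = 16 * X\<^sup>2 * (snd z \<bullet> b)\<^sup>2"
      by (simp add: G_def parabolic_size_deriv_def X_def power_mult_distrib)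
    also have "\<dots> \<le> 16 * w\<^sup>2 * w"
      using X xb by (intro mult_mono power_mono) auto
    finally have G: "G\<^sup>2 \<le> 16 * w ^ 3" by (simp add: power_numeral_reduce)
    have 1: "G\<^sup>2 / (L * (w\<^sup>2)\<^sup>2) \<le> 16 / (L * w)"
    proof -
      have "G\<^sup>2 / (L * (w\<^sup>2)\<^sup>2) \<le> 16 * w ^ 3 / (L * (w\<^sup>2)\<^sup>2)"
        using G L w by (intro divide_right_mono) auto
      also have "\<dots> = 16 / (L * w)" using L w by (simp add: power_numeral_reduce)
      finally show ?thesis .
    qed
    have 2: "(G / (L * w\<^sup>2))\<^sup>2 \<le> 16 / (L * w)"
    proof -
      have "(G / (L * w\<^sup>2))\<^sup>2 = G\<^sup>2 / (L * (w\<^sup>2)\<^sup>2) / L"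
        by (simp add: power_divide power_mult_distrib power2_eq_square)
      also have "\<dots> \<le> G\<^sup>2 / (L * (w\<^sup>2)\<^sup>2) / 1"
        using L by (intro divide_left_mono) auto
      finally show ?thesis using 1 by simp
    qed
    have 3: "(8 * (snd z \<bullet> b)\<^sup>2 + 4 * X) / (L * w\<^sup>2) \<le> 12 / (L * w)"
    proof -
      have "(8 * (snd z \<bullet> b)\<^sup>2 + 4 * X) / (L * w\<^sup>2) \<le> (12 * w) / (L * w\<^sup>2)"
        using X xb L w by (intro divide_right_mono) auto
      also have "\<dots> = 12 / (L * w)" using L w by (simp add: power2_eq_square)
      finally show ?thesis .
    qed
    have 4: "\<bar>G\<^sup>2 / (L * (w\<^sup>2)\<^sup>2) - (8 * (snd z \<bullet> b)\<^sup>2 + 4 * X) / (L * w\<^sup>2)\<bar> \<le> 28 / (L * w)"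
    proof -
      have "0 \<le> G\<^sup>2 / (L * (w\<^sup>2)\<^sup>2)" "0 \<le> (8 * (snd z \<bullet> b)\<^sup>2 + 4 * X) / (L * w\<^sup>2)"
        using L X by auto
      moreover have "16 / (L * w) + 12 / (L * w) = 28 / (L * w)"
        by (simp add: add_divide_distrib[symmetric])
      ultimately show ?thesis using 1 3 by linarith
    qed
    have "norm (dir_deriv (0, b) (dir_deriv (0, b) \<psi>) z) =
       \<bar>f2 * (G / (L * w\<^sup>2))\<^sup>2 +
        f1 * (G\<^sup>2 / (L * (w\<^sup>2)\<^sup>2) - (8 * (snd z \<bullet> b)\<^sup>2 + 4 * X) / (L * w\<^sup>2))\<bar>"
      unfolding \<psi>_def dir_deriv2_log_cutoff[OF b] norm_of_real f1_def f2_def G_def X_def w(2) ..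
    also have "\<dots> \<le> \<bar>f2\<bar> * (G / (L * w\<^sup>2))\<^sup>2 +
        \<bar>f1\<bar> * \<bar>G\<^sup>2 / (L * (w\<^sup>2)\<^sup>2) - (8 * (snd z \<bullet> b)\<^sup>2 + 4 * X) / (L * w\<^sup>2)\<bar>"
      by (rule order_trans[OF abs_triangle_ineq]) (simp add: abs_mult)
    also have "\<dots> \<le> \<bar>f2\<bar> * (28 / (L * w)) + \<bar>f1\<bar> * (28 / (L * w))"
      using 4 order_trans[OF 2, of "28 / (L * w)"] L w
      by (intro add_mono mult_left_mono) (auto simp: divide_right_mono)
    also have "\<dots> = 28 * (\<bar>f1\<bar> + \<bar>f2\<bar>) / (L * w)"
      by (simp add: add_divide_distrib algebra_simps)
    finally show ?thesis .
  qed
  have "norm (- \<i> * time_deriv \<psi> z + space_laplacian \<psi> z) \<le>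
      norm (time_deriv \<psi> z) + norm (space_laplacian \<psi> z)"
    by (rule order_trans[OF norm_triangle_ineq]) (simp add: norm_mult)
  also have "norm (space_laplacian \<psi> z) \<le> DIM('a) * (28 * (\<bar>f1\<bar> + \<bar>f2\<bar>) / (L * w))"
    unfolding space_laplacian_def by (rule sum_norm_bound[OF space])
  also note time
  also have "2 * \<bar>f1\<bar> / (L * w) + DIM('a) * (28 * (\<bar>f1\<bar> + \<bar>f2\<bar>) / (L * w)) \<le>
      DIM('a) * (2 * (\<bar>f1\<bar> + \<bar>f2\<bar>) / (L * w)) + DIM('a) * (28 * (\<bar>f1\<bar> + \<bar>f2\<bar>) / (L * w))"
  proof -
    have "2 * \<bar>f1\<bar> / (L * w) \<le> 1 * (2 * (\<bar>f1\<bar> + \<bar>f2\<bar>) / (L * w))"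
      using L w by (simp add: divide_right_mono)
    also have "\<dots> \<le> DIM('a) * (2 * (\<bar>f1\<bar> + \<bar>f2\<bar>) / (L * w))"
      using L w DIM_positive[where 'a='a] by (intro mult_right_mono) (auto simp: Suc_le_eq)
    finally show ?thesis by simp
  qed
  also have "\<dots> = 30 * DIM('a) * (\<bar>f1\<bar> + \<bar>f2\<bar>) / (L * w)"
    by (simp add: add_divide_distrib[symmetric] algebra_simps)
  finally show ?thesis unfolding f1_def f2_def w_def by simp
qed

section \<open>Absorption of the linear term\<close>

text \<open>
  The zeroth mode contributes \<open>1\<close> and the oscillating modes can cancel at most the sum of their moduli.
\<close>

lemma Re_homogeneous_nonlinearity_ge:
  assumes g: "(\<lambda>n. norm (g n)) summable_on UNIV" and g0: "g 0 = 1"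
  shows "(Re (g 0) - (\<Sum>\<^sub>\<infinity>n\<in>-{0}. norm (g n))) * norm z powr p \<le>
    Re (homogeneous_nonlinearity p g z)"
proof (cases "z = 0")
  case False
  define c where "c = (\<lambda>n. g n * exp (\<i> * of_int n * complex_of_real (Arg z)))"
  have nc: "norm (c n) = norm (g n)" for n
    by (simp add: c_def norm_mult)
  have abs: "(\<lambda>n. norm (c n)) summable_on - {0}"
    unfolding nc by (rule summable_on_subset_banach[OF g]) simp
  then have sc: "c summable_on - {0}" by (rule abs_summable_summable)
  have "infsum c (insert 0 (- {0})) = c 0 + infsum c (- {0})"
    by (rule infsum_insert[OF sc]) simp
  moreover have "insert 0 (- {0}) = (UNIV :: int set)" by auto
  ultimately have "infsum c UNIV = 1 + infsum c (- {0})" by (simp add: c_def g0)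
  moreover have "norm (infsum c (- {0})) \<le> (\<Sum>\<^sub>\<infinity>n\<in>-{0}. norm (g n))"
    using norm_infsum_bound[OF abs] by (simp add: nc)
  ultimately have "1 - (\<Sum>\<^sub>\<infinity>n\<in>-{0}. norm (g n)) \<le> Re (infsum c UNIV)"
    using abs_Re_le_cmod[of "infsum c (- {0})"] by simp
  then have "norm z powr p * (1 - (\<Sum>\<^sub>\<infinity>n\<in>-{0}. norm (g n))) \<le> norm z powr p * Re (infsum c UNIV)"
    by (intro mult_left_mono) auto
  then show ?thesis
    using False by (simp add: homogeneous_nonlinearity_def g0 c_def mult.commute)
qed (simp add: homogeneous_nonlinearity_def)

text \<open>
  Young's inequality for the conjugate exponents \<open>1 + 1 / q\<close> and \<open>1 + q\<close>, with a cruder constant. One of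
  the two terms on the right dominates, according to whether \<open>b \<le> m * a powr (1 / q)\<close>.
\<close>

lemma weighted_young:
  fixes a b m q :: real
  assumes "a \<ge> 0" "b \<ge> 0" "m > 0" "q > 0"
  shows "a * b \<le> m * a powr (1 + 1 / q) + m powr (- q) * b powr (1 + q)"
proof (cases "b \<le> m * a powr (1 / q)")
  case True
  then have "a * b \<le> a * (m * a powr (1 / q))" using assms by (intro mult_left_mono)
  also have "\<dots> = m * a powr (1 + 1 / q)"
    using assms by (cases "a = 0") (auto simp: powr_add)
  finally show ?thesis using assms by (simp add: add_increasing2)
next
  case False
  then have b: "b > 0" using assms by (smt (verit) mult_nonneg_nonneg powr_ge_zero)
  have "a = (a powr (1 / q)) powr q" using assms by (cases "a = 0") (auto simp: powr_powr)
  also have "\<dots> \<le> (b / m) powr q"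
    using False assms by (intro powr_mono2) (auto simp: field_simps)
  finally have "a * b \<le> (b / m) powr q * b" using b by (intro mult_right_mono) auto
  also have "\<dots> = m powr (- q) * b powr (1 + q)"
    using assms b by (simp add: powr_divide powr_add powr_minus field_simps)
  finally show ?thesis using assms by (simp add: add_increasing)
qed

text \<open>
  Young's inequality absorbs the linear term of the weak identity into the coercive part of the
  nonlinear one. What is left does not depend on the solution. The exponent \<open>1 + d / 2\<close> is conjugate to
  the degree \<open>1 + 2 / d\<close> of the nonlinearity. The constant is independent of \<open>L\<close>, which is essential
  because \<open>L\<close> is the quantity to be bounded.
\<close>

lemma weak_integrand_bound:
  fixes \<mu> :: real
  assumes \<mu>: "\<mu> > 0"
  shows "\<exists>K>0. \<forall>L\<ge>1. \<forall>z::real \<times> 'a::euclidean_space. \<forall>u Fu.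
    \<mu> * norm u powr (1 + 2 / DIM('a)) \<le> Re Fu \<longrightarrow>
    Re (u * (- \<i> * time_deriv (\<lambda>z. complex_of_real (log_cutoff L z)) z +
        space_laplacian (\<lambda>z. complex_of_real (log_cutoff L z)) z)) -
      Re (Fu * complex_of_real (log_cutoff L z)) \<le>
    (if parabolic_size z < exp L then K * (1 / (L * sqrt (parabolic_size z))) powr (1 + DIM('a) / 2)
     else 0)"
proof -
  define d where "d = real DIM('a)"
  have d: "d > 0" by (simp add: d_def)
  \<comment> \<open>The power of the cutoff that turns into its first power in Young's inequality.\<close>
  define \<theta> where "\<theta> = 1 / (1 + 2 / d)"
  define r where "r = 1 + 2 / d"
  have "r > 1" using d by (simp add: r_def)
  then have \<theta>: "\<theta> < 1" "\<theta> * (1 + 2 / d) = 1"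
    unfolding \<theta>_def r_def[symmetric] by simp_all
  obtain C1 where C1: "C1 \<ge> 0" "\<And>s. \<bar>flat (flat_poly 1) s\<bar> \<le> C1 * flat 1 s powr \<theta>"
    using flat_le_flat_powr[OF \<theta>(1)] by blast
  obtain C2 where C2: "C2 \<ge> 0" "\<And>s. \<bar>flat (flat_poly 2) s\<bar> \<le> C2 * flat 1 s powr \<theta>"
    using flat_le_flat_powr[OF \<theta>(1)] by blast
  define B where "B = 30 * d * (C1 + C2) + 1"
  have B: "B > 0" using C1 C2 d by (simp add: B_def add_nonneg_pos)
  define K where "K = \<mu> powr (- (d / 2)) * B powr (1 + d / 2)"
  have "K > 0" using \<mu> B by (simp add: K_def)
  moreover have "Re (u * (- \<i> * time_deriv (\<lambda>z. complex_of_real (log_cutoff L z)) z +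
        space_laplacian (\<lambda>z. complex_of_real (log_cutoff L z)) z)) -
      Re (Fu * complex_of_real (log_cutoff L z)) \<le>
    (if parabolic_size z < exp L then K * (1 / (L * sqrt (parabolic_size z))) powr (1 + d / 2) else 0)"
    if L: "L \<ge> 1" and Fu: "\<mu> * norm u powr (1 + 2 / d) \<le> Re Fu"
    for L u Fu and z :: "real \<times> 'a"
  proof -
    define D where "D = - \<i> * time_deriv (\<lambda>z. complex_of_real (log_cutoff L z)) z +
        space_laplacian (\<lambda>z. complex_of_real (log_cutoff L z)) z"
    define h where "h = log_cutoff L z"
    define w where "w = sqrt (parabolic_size z)"
    define S where "S = \<bar>flat (flat_poly 1) (log_level L z)\<bar> + \<bar>flat (flat_poly 2) (log_level L z)\<bar>"
    have h: "h \<ge> 0" by (simp add: h_def log_cutoff_def flat_one_nonneg)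
    have w: "w \<ge> 1" using parabolic_size_ge_one[of z] by (simp add: w_def)
    have D: "norm D \<le> 30 * d * S / (L * w)"
      using norm_dual_operator_log_cutoff[OF L, of z] by (simp add: D_def w_def S_def d_def)
    show ?thesis
    proof (cases "parabolic_size z < exp L")
      case False
      then have "S = 0" "h = 0"
        using flat_log_level_eq_0[of L z] L by (auto simp: S_def h_def log_cutoff_def)
      then have "D = 0" "h = 0" using D by auto
      then show ?thesis using False unfolding D_def[symmetric] h_def[symmetric] by simp
    next
      case True
      have S: "S \<le> (C1 + C2) * h powr \<theta>"
        using C1(2)[of "log_level L z"] C2(2)[of "log_level L z"]
        by (simp add: S_def h_def log_cutoff_def algebra_simps)
      have "norm D \<le> 30 * d * ((C1 + C2) * h powr \<theta>) / (L * w)"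
        using D by (rule order_trans) (use S d L w in \<open>intro divide_right_mono mult_left_mono; simp\<close>)
      also have "\<dots> = 30 * d * (C1 + C2) * h powr \<theta> / (L * w)" by simp
      also have "\<dots> \<le> B * h powr \<theta> / (L * w)"
        using L w by (intro divide_right_mono mult_right_mono) (auto simp: B_def)
      finally have "norm u * norm D \<le> norm u * (B * h powr \<theta> / (L * w))"
        by (intro mult_left_mono) auto
      also have "\<dots> = (norm u * h powr \<theta>) * (B / (L * w))" by simp
      also have "\<dots> \<le> \<mu> * (norm u * h powr \<theta>) powr (1 + 1 / (d / 2)) +
          \<mu> powr (- (d / 2)) * (B / (L * w)) powr (1 + d / 2)"
        using d B L w \<mu> by (intro weighted_young) auto
      also have "(norm u * h powr \<theta>) powr (1 + 1 / (d / 2)) = norm u powr (1 + 2 / d) * h"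
        using h \<theta>(2) by (simp add: powr_mult powr_powr)
      also have "(B / (L * w)) powr (1 + d / 2) = B powr (1 + d / 2) * (1 / (L * w)) powr (1 + d / 2)"
        using B L w powr_mult[of B "1 / (L * w)" "1 + d / 2"] by simp
      finally have 1: "norm u * norm D \<le> \<mu> * norm u powr (1 + 2 / d) * h +
          K * (1 / (L * w)) powr (1 + d / 2)" by (simp add: K_def mult.assoc)
      have "Re (u * D) \<le> norm u * norm D"
        using complex_Re_le_cmod[of "u * D"] by (simp add: norm_mult)
      moreover have "\<mu> * norm u powr (1 + 2 / d) * h \<le> Re (Fu * complex_of_real h)"
        using mult_right_mono[OF Fu h] by simp
      ultimately show ?thesis
        using 1 True unfolding D_def[symmetric] h_def[symmetric] w_def[symmetric] by simp
    qed
  qed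
  ultimately show ?thesis unfolding d_def by blast
qed

section \<open>The space-time integral\<close>

text \<open>
  Boxes that contain the sublevel sets \<open>{z. parabolic_size z \<le> exp j}\<close> and whose volume has the same
  order of magnitude.
\<close>

definition parabolic_box :: "nat \<Rightarrow> (real \<times> 'a::euclidean_space) set" where
  "parabolic_box j = cbox (- exp (real j / 2), - (exp (real j / 4) *\<^sub>R One)) (exp (real j / 2), exp (real j / 4) *\<^sub>R One)"

lemma mem_parabolic_box:
  assumes "parabolic_size z \<le> exp (real j)"
  shows "z \<in> parabolic_box j"
proof -
  have s: "sqrt (exp (real j)) = exp (real j / 2)" "sqrt (exp (real j / 2)) = exp (real j / 4)"
    by (rule real_sqrt_unique; simp flip: exp_of_nat_mult)+
  note b = parabolic_size_bounds[OF assms, unfolded s]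
  have "\<bar>snd z \<bullet> i\<bar> \<le> exp (real j / 4)" if "i \<in> Basis" for i
    using Basis_le_norm[OF that, of "snd z"] b(2) by linarith
  then have "snd z \<in> cbox (- (exp (real j / 4) *\<^sub>R One)) (exp (real j / 4) *\<^sub>R One)"
    by (auto simp: mem_box abs_le_iff minus_le_iff)
  moreover have "fst z \<in> cbox (- exp (real j / 2)) (exp (real j / 2))"
    using b(1) by auto
  ultimately show ?thesis
    by (simp add: parabolic_box_def cbox_Pair_eq mem_Times_iff)
qed

lemma measure_parabolic_box:
  "measure lebesgue (parabolic_box j :: (real \<times> 'a::euclidean_space) set) =
    2 ^ (DIM('a) + 1) * exp (j * (real DIM('a) + 2) / 4)"
proof -
  have "measure lebesgue (parabolic_box j :: (real \<times> 'a) set) =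
     measure lborel (cbox (- exp (real j / 2)) (exp (real j / 2))) *
     measure lborel (cbox (- (exp (real j / 4) *\<^sub>R One)) (exp (real j / 4) *\<^sub>R One) :: 'a set)"
    by (simp add: parabolic_box_def content_Pair)
  also have "measure lborel (cbox (- (exp (real j / 4) *\<^sub>R One)) (exp (real j / 4) *\<^sub>R One) :: 'a set) =
      (2 * exp (real j / 4)) ^ DIM('a)"
    by (subst content_cbox) (auto intro: order_trans[of _ 0])
  also have "measure lborel (cbox (- exp (real j / 2)) (exp (real j / 2))) = 2 * exp (real j / 2)"
    by simp
  also have "2 * exp (real j / 2) * (2 * exp (real j / 4)) ^ DIM('a) =
      2 ^ (DIM('a) + 1) * (exp (real j / 2) * exp (real j / 4) ^ DIM('a))"
    by (simp add: power_mult_distrib)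
  also have "exp (real j / 2) * exp (real j / 4) ^ DIM('a) = exp (j * (real DIM('a) + 2) / 4)"
    by (simp flip: exp_of_nat_mult exp_add add: field_simps)
  finally show ?thesis .
qed

text \<open>
  On the layer \<open>exp k \<le> parabolic_size z < exp (k + 1)\<close> the weight is at most its value at the inner
  edge. The volume of the box of index \<open>k + 1\<close> compensates this value up to a constant, so each of the
  about \<open>L\<close> layers contributes the same: the degree \<open>1 + 2 / d\<close> is the critical one.
\<close>

lemma parabolic_weight_le_boxes:
  fixes z :: "real \<times> 'a::euclidean_space"
  assumes L: "L \<ge> 1" and z: "parabolic_size z < exp L"
  shows "(1 / (L * sqrt (parabolic_size z))) powr (1 + DIM('a) / 2) \<le>
    (\<Sum>k<Suc (nat \<lfloor>L\<rfloor>). L powr (- (1 + DIM('a) / 2)) * exp (- (k * (real DIM('a) + 2) / 4)) *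
      indicat_real (parabolic_box (Suc k)) z)"
    (is "?lhs \<le> sum ?t _")
proof -
  define d where "d = real DIM('a)"
  define k where "k = nat \<lfloor>ln (parabolic_size z)\<rfloor>"
  have pos: "parabolic_size z > 0" and one: "parabolic_size z \<ge> 1"
    by (rule parabolic_size_pos, rule parabolic_size_ge_one)
  then have ln0: "ln (parabolic_size z) \<ge> 0" by simp
  then have k: "real k \<le> ln (parabolic_size z)" "ln (parabolic_size z) < real k + 1"
    unfolding k_def by linarith+
  have lnL: "ln (parabolic_size z) < L" using ln_less_cancel_iff[OF pos, of "exp L"] z by simp
  have kN: "k < Suc (nat \<lfloor>L\<rfloor>)"
    unfolding k_def using lnL by (intro le_imp_less_Suc nat_mono floor_mono) simp
  have box: "z \<in> parabolic_box (Suc k)"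
    using k(2) ln_le_cancel_iff[OF pos, of "exp (real (Suc k))"] by (intro mem_parabolic_box) simp
  have "?lhs = L powr (- (1 + d / 2)) * (sqrt (parabolic_size z)) powr (- (1 + d / 2))"
    using L pos by (simp add: d_def powr_divide powr_mult powr_minus field_simps)
  also have "(sqrt (parabolic_size z)) powr (- (1 + d / 2)) =
      exp (- (ln (parabolic_size z) * (d + 2) / 4))"
    using pos by (simp add: powr_def ln_sqrt field_simps)
  also have "\<dots> \<le> exp (- (k * (d + 2) / 4))"
    using k by (simp add: d_def divide_right_mono mult_right_mono)
  finally have "?lhs \<le> ?t k"
    using box L by (simp add: d_def mult_left_mono)
  also have "\<dots> \<le> sum ?t {..<Suc (nat \<lfloor>L\<rfloor>)}"
    using kN by (intro member_le_sum) auto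
  finally show ?thesis .
qed

text \<open>
  The pointwise bound is integrated over space-time. There are about \<open>L\<close> layers with equal
  contributions, which turns the power \<open>- (1 + d / 2)\<close> of the integrand into \<open>- (d / 2)\<close>.
\<close>

lemma weak_solution_data_bound:
  fixes \<mu> :: real
  assumes \<mu>: "\<mu> > 0"
  shows "\<exists>K>0. \<forall>F (u0 :: 'a::euclidean_space \<Rightarrow> complex) T u L.
    (\<forall>w. \<mu> * norm w powr (1 + 2 / DIM('a)) \<le> Re (F w)) \<longrightarrow>
    weak_solution F u0 T u \<longrightarrow> L \<ge> 1 \<longrightarrow> exp (L / 2) \<le> T \<longrightarrow>
    Re (\<i> * (LINT x|lebesgue. u0 x * complex_of_real (log_cutoff L (0, x)))) \<le>
      K * L powr (- (DIM('a) / 2))"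
proof -
  define d where "d = real DIM('a)"
  obtain K where K: "K > 0" and bound: "\<And>L (z::real \<times> 'a) u Fu. L \<ge> 1 \<Longrightarrow>
    \<mu> * norm u powr (1 + 2 / d) \<le> Re Fu \<Longrightarrow>
    Re (u * (- \<i> * time_deriv (\<lambda>z. complex_of_real (log_cutoff L z)) z +
        space_laplacian (\<lambda>z. complex_of_real (log_cutoff L z)) z)) -
      Re (Fu * complex_of_real (log_cutoff L z)) \<le>
    (if parabolic_size z < exp L then K * (1 / (L * sqrt (parabolic_size z))) powr (1 + d / 2)
     else 0)"
    using weak_integrand_bound[OF \<mu>, where 'a='a] unfolding d_def by blast
  define M where "M = 2 * K * (2 ^ (DIM('a) + 1) * exp ((d + 2) / 4))"
  have "M > 0" using K by (simp add: M_def)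
  moreover have "Re (\<i> * (LINT x|lebesgue. u0 x * complex_of_real (log_cutoff L (0, x)))) \<le>
      M * L powr (- (d / 2))"
    if F: "\<And>w. \<mu> * norm w powr (1 + 2 / d) \<le> Re (F w)"
      and u: "weak_solution F u0 T u" and L: "L \<ge> 1" and T: "exp (L / 2) \<le> T"
    for F and u0 :: "'a \<Rightarrow> complex" and T u L
  proof -
    define \<Omega> where "\<Omega> = {0<..<T} \<times> (UNIV :: 'a set)"
    define \<psi> where "\<psi> = (\<lambda>z::real \<times> 'a. complex_of_real (log_cutoff L z))"
    define A where "A = (\<lambda>z. u z * (- \<i> * time_deriv \<psi> z + space_laplacian \<psi> z))"
    define B where "B = (\<lambda>z. F (u z) * \<psi> z)"
    define N where "N = Suc (nat \<lfloor>L\<rfloor>)"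
    define c where "c = (\<lambda>k::nat. K * (L powr (- (1 + d / 2)) * exp (- (k * (d + 2) / 4))))"
    have c: "c k \<ge> 0" for k using K by (simp add: c_def)
    have "test_function ({..<T} \<times> UNIV) \<psi>"
      using test_function_log_cutoff[OF _ T] L by (simp add: \<psi>_def)
    then have iA: "set_integrable lebesgue \<Omega> A" and iB: "set_integrable lebesgue \<Omega> B"
      and id: "(LINT z:\<Omega>|lebesgue. A z) =
        \<i> * (LINT x|lebesgue. u0 x * \<psi> (0, x)) + (LINT z:\<Omega>|lebesgue. B z)"
      using u unfolding weak_solution_def A_def B_def \<Omega>_def by blast+
    let ?S = "\<lambda>z::real \<times> 'a. \<Sum>k<N. c k * indicat_real (parabolic_box (Suc k)) z"
    \<comment> \<open>Only the difference of the two integrands is estimated: the Young bound has the nonlinear term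
        on the left, where the weak formulation provides its integrability.\<close>
    have pw: "Re (A z) - Re (B z) \<le> ?S z" for z
    proof -
      have "Re (A z) - Re (B z) \<le>
        (if parabolic_size z < exp L then K * (1 / (L * sqrt (parabolic_size z))) powr (1 + d / 2) else 0)"
        unfolding A_def B_def \<psi>_def by (rule bound[OF L F])
      also have "\<dots> \<le> ?S z"
      proof (cases "parabolic_size z < exp L")
        case True
        then show ?thesis
          using mult_left_mono[OF parabolic_weight_le_boxes[OF L True], of K] K
          by (simp add: N_def c_def d_def sum_distrib_left mult.assoc del: sum.lessThan_Suc)
      next
        case False
        then show ?thesis using c by (auto intro!: sum_nonneg)
      qed
      finally show ?thesis .
    qed
    have S0: "?S z \<ge> 0" for z using c by (intro sum_nonneg) auto
    have ibox: "integrable lebesgue (indicat_real (parabolic_box j :: (real \<times> 'a) set))" for j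
      unfolding parabolic_box_def by (rule integrable_real_indicator) (auto simp: emeasure_lborel_cbox_eq)
    have iS: "integrable lebesgue ?S"
      using ibox by (intro Bochner_Integration.integrable_sum integrable_mult_right)
    have iAB: "integrable lebesgue (\<lambda>z. indicator \<Omega> z *\<^sub>R A z - indicator \<Omega> z *\<^sub>R B z)"
      using iA iB unfolding set_integrable_def by (rule Bochner_Integration.integrable_diff)
    have "Re (\<i> * (LINT x|lebesgue. u0 x * \<psi> (0, x))) =
        Re ((LINT z:\<Omega>|lebesgue. A z) - (LINT z:\<Omega>|lebesgue. B z))"
      using id by simp
    also have "\<dots> = Re (LINT z|lebesgue. indicator \<Omega> z *\<^sub>R A z - indicator \<Omega> z *\<^sub>R B z)"
      using iA iB unfolding set_integrable_def set_lebesgue_integral_def by simp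
    also have "\<dots> = (LINT z|lebesgue. Re (indicator \<Omega> z *\<^sub>R A z - indicator \<Omega> z *\<^sub>R B z))"
      using iAB by (rule integral_Re[symmetric])
    also have "\<dots> \<le> (LINT z|lebesgue. ?S z)"
    proof (rule integral_mono)
      show "integrable lebesgue (\<lambda>z. Re (indicator \<Omega> z *\<^sub>R A z - indicator \<Omega> z *\<^sub>R B z))"
        using iAB by (rule integrable_Re)
      show "Re (indicator \<Omega> z *\<^sub>R A z - indicator \<Omega> z *\<^sub>R B z) \<le> ?S z" for z
        using pw[of z] S0[of z] by (cases "z \<in> \<Omega>") auto
    qed (rule iS)
    also have "\<dots> = (\<Sum>k<N. c k * measure lebesgue (parabolic_box (Suc k) :: (real \<times> 'a) set))"
      by (simp only: Bochner_Integration.integral_sum[OF integrable_mult_right[OF ibox]]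
          integral_mult_right_zero) simp
    also have "\<dots> = (\<Sum>k<N. K * L powr (- (1 + d / 2)) * (2 ^ (DIM('a) + 1) * exp ((d + 2) / 4)))"
    proof (rule sum.cong[OF refl])
      fix k
      have "exp (- (k * (d + 2) / 4)) * exp (Suc k * (d + 2) / 4) = exp ((d + 2) / 4)"
        by (simp flip: exp_add add: field_simps)
      then show "c k * measure lebesgue (parabolic_box (Suc k) :: (real \<times> 'a) set) =
          K * L powr (- (1 + d / 2)) * (2 ^ (DIM('a) + 1) * exp ((d + 2) / 4))"
        unfolding c_def measure_parabolic_box d_def by (simp add: mult.assoc mult.left_commute)
    qed
    also have "\<dots> = N * (K * L powr (- (1 + d / 2)) * (2 ^ (DIM('a) + 1) * exp ((d + 2) / 4)))"
      by simp
    also have "\<dots> \<le> (2 * L) * (K * L powr (- (1 + d / 2)) * (2 ^ (DIM('a) + 1) * exp ((d + 2) / 4)))"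
    proof (rule mult_right_mono)
      show "real N \<le> 2 * L" unfolding N_def using L by linarith
    qed (use K in auto)
    also have "\<dots> = M * (L * L powr (- (1 + d / 2)))" by (simp add: M_def)
    also have "L * L powr (- (1 + d / 2)) = L powr (- (d / 2))"
      using L powr_add[of L 1 "- (1 + d / 2)"] by simp
    finally show ?thesis by (simp add: \<psi>_def)
  qed
  ultimately show ?thesis unfolding d_def by blast
qed

section \<open>Lower bounds for the initial data\<close>

lemma integrable_data_mult_log_cutoff:
  fixes f :: "'a::euclidean_space \<Rightarrow> complex"
  assumes f: "Lp_loc 1 UNIV f" and L: "L > 0"
  shows "integrable lebesgue (\<lambda>x. f x * complex_of_real (log_cutoff L (0, x)))"
proof -
  let ?K = "cball 0 (exp (L / 4)) :: 'a set"
  have mf: "f \<in> borel_measurable lebesgue"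
    using f by (simp add: Lp_loc_def lebesgue_on_UNIV_eq)
  have iK: "integrable lebesgue (\<lambda>x. indicat_real ?K x *\<^sub>R (norm (f x) powr 1))"
    using f unfolding Lp_loc_def set_integrable_def by (meson compact_cball top_greatest)
  have sqrt: "sqrt (exp L) = exp (L / 2)" "sqrt (exp (L / 2)) = exp (L / 4)"
    by (rule real_sqrt_unique; simp flip: exp_of_nat_mult)+
  have "continuous_on UNIV (\<lambda>z::real \<times> 'a. log_cutoff L z)"
    unfolding log_cutoff_def
    using flat_log_level_has_derivative[of 0 L]
    by (intro has_derivative_continuous_on) (auto simp: flat_poly_def)
  then have "continuous_on UNIV (\<lambda>x::'a. log_cutoff L (0, x))"
    by (rule continuous_on_compose2) (auto intro: continuous_intros)
  then have mc: "(\<lambda>x::'a. log_cutoff L (0, x)) \<in> borel_measurable lebesgue"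
    by (intro measurable_completion) (simp add: borel_measurable_continuous_onI)
  have supp: "log_cutoff L (0, x) = 0" if "x \<notin> ?K" for x
  proof -
    have "\<not> parabolic_size (0::real, x) \<le> exp L"
      using parabolic_size_bounds(2)[of "(0::real, x)" "exp L", unfolded sqrt] that by auto
    then show ?thesis using flat_log_level_eq_0[OF L, of "(0, x)" 1] by (simp add: log_cutoff_def)
  qed
  show ?thesis
  proof (rule Bochner_Integration.integrable_bound[OF iK])
    show "(\<lambda>x. f x * complex_of_real (log_cutoff L (0, x))) \<in> borel_measurable lebesgue"
      using mf mc by measurable
    have "norm (f x * complex_of_real (log_cutoff L (0, x))) \<le>
        norm (indicat_real ?K x *\<^sub>R (norm (f x) powr 1))" for x
    proof (cases "x \<in> ?K")
      case True
      have "\<bar>log_cutoff L (0, x)\<bar> \<le> 1"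
        by (simp add: log_cutoff_def flat_one_le_one flat_one_nonneg)
      then have "norm (f x) * \<bar>log_cutoff L (0, x)\<bar> \<le> norm (f x) * 1"
        by (intro mult_left_mono) auto
      then show ?thesis using True by (simp add: norm_mult)
    qed (simp add: supp)
    then show "AE x in lebesgue. norm (f x * complex_of_real (log_cutoff L (0, x))) \<le>
        norm (indicat_real ?K x *\<^sub>R (norm (f x) powr 1))" by simp
  qed
qed

text \<open>
  Disjoint shells on which \<open>ln (norm x)\<close> lies between \<open>j - 1\<close> and \<open>j\<close>. The volume of a shell compensates
  the factor \<open>norm x powr (- d)\<close> of the data.
\<close>

definition exp_shell :: "nat \<Rightarrow> 'a::euclidean_space set" where
  "exp_shell j = ball 0 (exp j) - ball 0 (exp (real j - 1))"

lemma measure_exp_shell_ge: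
  "exp_shell j \<in> lmeasurable"
  "measure lebesgue (exp_shell j :: 'a::euclidean_space set) \<ge>
    unit_ball_vol DIM('a) * (1 - exp (-1)) * exp (real j) ^ DIM('a)"
proof -
  show "exp_shell j \<in> lmeasurable"
    unfolding exp_shell_def by (intro fmeasurable.Diff lmeasurable_ball)
  have d: "DIM('a) \<ge> 1" by (simp add: Suc_le_eq)
  have "measure lebesgue (exp_shell j :: 'a set) =
      measure lebesgue (ball 0 (exp j) :: 'a set) - measure lebesgue (ball 0 (exp (real j - 1)) :: 'a set)"
    unfolding exp_shell_def
    by (rule measurable_measure_Diff) (simp_all add: subset_ball)
  also have "\<dots> = unit_ball_vol DIM('a) * (exp (real j) ^ DIM('a) - exp (real j - 1) ^ DIM('a))"
    by (simp add: content_ball algebra_simps)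
  also have "exp (real j - 1) ^ DIM('a) = exp (real j) ^ DIM('a) * exp (-1) ^ DIM('a)"
    by (simp add: exp_diff exp_minus power_divide field_simps power_mult_distrib[symmetric])
  also have "unit_ball_vol DIM('a) * (exp (real j) ^ DIM('a) - exp (real j) ^ DIM('a) * exp (-1) ^ DIM('a)) =
      unit_ball_vol DIM('a) * (1 - exp (-1) ^ DIM('a)) * exp (real j) ^ DIM('a)"
    by (simp add: algebra_simps)
  also have "\<dots> \<ge> unit_ball_vol DIM('a) * (1 - exp (-1)) * exp (real j) ^ DIM('a)"
  proof (intro mult_right_mono mult_left_mono)
    show "1 - exp (- 1) \<le> 1 - (exp (-1) :: real) ^ DIM('a)"
      using power_decreasing[OF d, of "exp (-1::real)"] by simp
  qed auto
  finally show "measure lebesgue (exp_shell j :: 'a set) \<ge>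
    unit_ball_vol DIM('a) * (1 - exp (-1)) * exp (real j) ^ DIM('a)" .
qed

text \<open>
  Replaces \<open>ln (norm x)\<close> by the index of the shell, for either sign of \<open>\<alpha>\<close>.
\<close>

lemma powr_comparable:
  fixes x y \<alpha> :: real
  assumes "y / 2 \<le> x" "x \<le> y" "y > 0"
  shows "x powr (- \<alpha>) \<ge> min 1 (2 powr \<alpha>) * y powr (- \<alpha>)"
proof (cases "\<alpha> \<ge> 0")
  case True
  have "min 1 (2 powr \<alpha>) * y powr (- \<alpha>) \<le> 1 * y powr (- \<alpha>)"
    by (intro mult_right_mono) auto
  also have "\<dots> \<le> x powr (- \<alpha>)"
    using True assms powr_mono2'[of "- \<alpha>" x y] by simp
  finally show ?thesis .
next
  case False
  have "min 1 (2 powr \<alpha>) * y powr (- \<alpha>) \<le> 2 powr \<alpha> * y powr (- \<alpha>)"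
    by (intro mult_right_mono) auto
  also have "\<dots> = (y / 2) powr (- \<alpha>)"
    using assms by (simp add: powr_divide powr_minus field_simps)
  also have "\<dots> \<le> x powr (- \<alpha>)"
    using False assms by (intro powr_mono2) auto
  finally show ?thesis .
qed

lemma log_cutoff_ge_on_ball:
  assumes L: "L > 0" and x: "norm x \<le> exp (real N)" and N: "4 * real N + 1 \<le> L / 2"
  shows "log_cutoff L (0, x) \<ge> exp (-2)"
proof -
  have "(x \<bullet> x)\<^sup>2 = norm x ^ 4" by (simp flip: power2_norm_eq_inner power_mult)
  also have "\<dots> \<le> exp (real N) ^ 4" using x by (intro power_mono) auto
  also have "\<dots> = exp (4 * real N)" by (simp flip: exp_of_nat_mult)
  finally have "parabolic_size (0::real, x) \<le> 1 + exp (4 * real N)"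
    by (simp add: parabolic_size_def)
  also have "\<dots> \<le> exp (4 * real N) * 2" by simp
  also have "\<dots> \<le> exp (4 * real N) * exp 1"
    using exp_ge_add_one_self[of 1] by (intro mult_left_mono) auto
  also have "\<dots> \<le> exp (L / 2)" using N by (simp flip: exp_add)
  finally have "ln (parabolic_size (0::real, x)) \<le> L / 2"
    using ln_le_cancel_iff[OF parabolic_size_pos, of "exp (L / 2)" "(0::real, x)"] by simp
  then have "log_level L (0, x) \<ge> 1 / 2" using L by (simp add: log_level_def field_simps)
  then show ?thesis unfolding log_cutoff_def by (rule flat_one_ge)
qed

text \<open>
  The shells of index \<open>m\<close> to \<open>N\<close> lie outside the ball of radius \<open>R0\<close> and inside the region where the
  cutoff is at least \<open>exp (-2)\<close>. On each of them the data and the volume multiply to a constant times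
  \<open>j powr (- \<alpha>)\<close>.
\<close>

lemma data_integral_ge_sum:
  fixes f :: "'a::euclidean_space \<Rightarrow> complex"
  assumes f: "Lp_loc 1 UNIV f" and L: "L > 0" and N: "4 * real N + 1 \<le> L / 2"
    and m: "m \<ge> 2" "exp (real m - 1) > R0"
    and lower: "AE x in lebesgue. - Im (f x) \<ge>
       (if norm x > R0 then norm x powr (- real DIM('a)) * ln (norm x) powr (- \<alpha>) else 0)"
  shows "- Im (LINT x|lebesgue. f x * complex_of_real (log_cutoff L (0, x))) \<ge>
    exp (-2) * min 1 (2 powr \<alpha>) * unit_ball_vol DIM('a) * (1 - exp (-1)) *
    (\<Sum>j=m..N. real j powr (- \<alpha>))"
proof -
  define \<kappa> where "\<kappa> = min 1 (2 powr \<alpha>)"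
  have \<kappa>: "\<kappa> > 0" by (simp add: \<kappa>_def)
  define c where "c = (\<lambda>j::nat. exp (-2) * (\<kappa> * real j powr (- \<alpha>) / exp (real j) ^ DIM('a)))"
  have c: "c j \<ge> 0" for j using \<kappa> by (simp add: c_def)
  let ?S = "\<lambda>x::'a. \<Sum>j=m..N. c j * indicat_real (exp_shell j) x"
  have ishell: "integrable lebesgue (indicat_real (exp_shell j :: 'a set))" for j
    using measure_exp_shell_ge(1)[of j] by (auto simp: fmeasurable_def intro: integrable_real_indicator)
  have int: "integrable lebesgue (\<lambda>x. f x * complex_of_real (log_cutoff L (0, x)))"
    using f L by (rule integrable_data_mult_log_cutoff)
  have pw: "?S x \<le> - Im (f x) * log_cutoff L (0, x)"
    if x: "- Im (f x) \<ge> (if norm x > R0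
      then norm x powr (- real DIM('a)) * ln (norm x) powr (- \<alpha>) else 0)" for x
  proof -
    have Im0: "- Im (f x) \<ge> 0" using x by (smt (verit) mult_nonneg_nonneg powr_ge_zero)
    have \<psi>0: "log_cutoff L (0, x) \<ge> 0" by (simp add: log_cutoff_def flat_one_nonneg)
    show ?thesis
    proof (cases "\<exists>j\<in>{m..N}. x \<in> exp_shell j")
      case False
      then have "?S x = 0" by (intro sum.neutral) auto
      then show ?thesis using mult_nonneg_nonneg[OF Im0 \<psi>0] by simp
    next
      case True
      then obtain j where j: "m \<le> j" "j \<le> N" "x \<in> exp_shell j" by auto
      then have nx: "exp (real j - 1) \<le> norm x" "norm x < exp (real j)"
        by (auto simp: exp_shell_def)
      have uniq: "i = j" if "x \<in> exp_shell i" for i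
      proof -
        have "exp (real i - 1) \<le> norm x" "norm x < exp (real i)"
          using that by (auto simp: exp_shell_def)
        then have "exp (real i - 1) < exp (real j)" "exp (real j - 1) < exp (real i)"
          using nx by linarith+
        then show ?thesis by simp
      qed
      have "?S x = (\<Sum>i\<in>{m..N}. if i = j then c j else 0)"
      proof (rule sum.cong[OF refl])
        fix i
        show "c i * indicat_real (exp_shell i) x = (if i = j then c j else 0)"
          using uniq[of i] j(3) by (cases "i = j") (auto simp: indicator_def)
      qed
      also have "\<dots> = c j" using j by simp
      finally have S: "?S x = c j" .
      have pos: "norm x > 0" using nx(1) exp_gt_zero[of "real j - 1"] by linarith
      have "exp (real m - 1) \<le> exp (real j - 1)" using j by simp
      then have R: "norm x > R0" using m(2) nx(1) by linarith
      have ln: "real j - 1 \<le> ln (norm x)" "ln (norm x) \<le> real j"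
        using nx ln_le_cancel_iff[OF exp_gt_zero pos, of "real j - 1"]
          ln_le_cancel_iff[OF pos exp_gt_zero, of "real j"] by auto
      have 1: "\<kappa> * real j powr (- \<alpha>) \<le> ln (norm x) powr (- \<alpha>)"
        unfolding \<kappa>_def using ln j m by (intro powr_comparable) auto
      have "norm x ^ DIM('a) \<le> exp (real j) ^ DIM('a)"
        using nx by (intro power_mono) auto
      then have 2: "1 / exp (real j) ^ DIM('a) \<le> norm x powr (- real DIM('a))"
        using pos by (simp add: powr_minus powr_realpow field_simps)
      have "\<kappa> * real j powr (- \<alpha>) / exp (real j) ^ DIM('a) =
          1 / exp (real j) ^ DIM('a) * (\<kappa> * real j powr (- \<alpha>))" by simp
      also have "\<dots> \<le> norm x powr (- real DIM('a)) * ln (norm x) powr (- \<alpha>)"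
        using 1 2 \<kappa> by (intro mult_mono) auto
      also have "\<dots> \<le> - Im (f x)" using x R by simp
      finally have 3: "\<kappa> * real j powr (- \<alpha>) / exp (real j) ^ DIM('a) \<le> - Im (f x)" .
      have "norm x \<le> exp (real N)" using nx(2) j(2) by (smt (verit) exp_le_cancel_iff of_nat_le_iff)
      then have "log_cutoff L (0, x) \<ge> exp (-2)" using L N by (intro log_cutoff_ge_on_ball)
      then have "c j \<le> log_cutoff L (0, x) * - Im (f x)"
        unfolding c_def using 3 \<kappa> \<psi>0 by (intro mult_mono) auto
      then show ?thesis using S by (simp add: mult.commute)
    qed
  qed
  have "exp (-2) * \<kappa> * unit_ball_vol DIM('a) * (1 - exp (-1)) * (\<Sum>j=m..N. real j powr (- \<alpha>)) =
     (\<Sum>j=m..N. c j * (unit_ball_vol DIM('a) * (1 - exp (-1)) * exp (real j) ^ DIM('a)))"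
    by (simp add: c_def sum_distrib_left mult.assoc mult.left_commute)
  also have "\<dots> \<le> (\<Sum>j=m..N. c j * measure lebesgue (exp_shell j :: 'a set))"
    by (intro sum_mono mult_left_mono measure_exp_shell_ge(2) c)
  also have "\<dots> = (LINT x|lebesgue. ?S x)"
    by (simp only: Bochner_Integration.integral_sum[OF integrable_mult_right[OF ishell]]
        integral_mult_right_zero) simp
  also have "\<dots> \<le> (LINT x|lebesgue. - Im (f x * complex_of_real (log_cutoff L (0, x))))"
  proof (rule integral_mono_AE)
    show "integrable lebesgue ?S"
      by (intro Bochner_Integration.integrable_sum integrable_mult_right ishell)
    show "integrable lebesgue (\<lambda>x. - Im (f x * complex_of_real (log_cutoff L (0, x))))"
      by (intro Bochner_Integration.integrable_minus integrable_Im int)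
    show "AE x in lebesgue. ?S x \<le> - Im (f x * complex_of_real (log_cutoff L (0, x)))"
      using lower by eventually_elim (use pw in simp)
  qed
  also have "\<dots> = - Im (LINT x|lebesgue. f x * complex_of_real (log_cutoff L (0, x)))"
    using integral_Im[OF int] by simp
  finally show ?thesis by (simp add: \<kappa>_def)
qed

text \<open>
  The order of growth of \<open>\<Sum>j\<le>L. j powr (- \<alpha>)\<close>.
\<close>

definition data_growth :: "real \<Rightarrow> real \<Rightarrow> real" where
  "data_growth \<alpha> L = (if \<alpha> > 1 then 1 else if \<alpha> = 1 then ln L else L powr (1 - \<alpha>))"

lemma sum_inverse_ge_ln:
  assumes "m \<ge> 1" "m \<le> N"
  shows "ln (real (Suc N) / real m) \<le> (\<Sum>j=m..N. 1 / real j)"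
  using assms(2)
proof (induction N rule: dec_induct)
  case base
  have "ln (1 + 1 / real m) \<le> 1 / real m" by (rule ln_add_one_self_le_self) simp
  moreover have "real (Suc m) / real m = 1 + 1 / real m" using assms(1) by (simp add: add_divide_distrib)
  ultimately show ?case by simp
next
  case (step N)
  have "ln (real (Suc (Suc N)) / real m) =
      ln (real (Suc N) / real m * (1 + 1 / real (Suc N)))"
  proof -
    have "real (Suc N) * (1 + 1 / real (Suc N)) = real (Suc (Suc N))" by (simp add: distrib_left)
    then show ?thesis by (simp only: times_divide_eq_left)
  qed
  also have "\<dots> = ln (real (Suc N) / real m) + ln (1 + 1 / real (Suc N))"
    using assms(1) by (intro ln_mult_pos) (auto intro: add_pos_nonneg)
  also have "ln (1 + 1 / real (Suc N)) \<le> 1 / real (Suc N)"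
    by (rule ln_add_one_self_le_self) simp
  finally show ?case using step by simp
qed

lemma sum_powr_ge_data_growth:
  assumes m: "m \<ge> 1"
  shows "\<exists>c>0. \<exists>L0\<ge>1. \<forall>L\<ge>L0. c * data_growth \<alpha> L \<le>
    (\<Sum>j=m..nat \<lfloor>(L - 2) / 8\<rfloor>. real j powr (- \<alpha>))"
proof -
  define N where "N = (\<lambda>L::real. nat \<lfloor>(L - 2) / 8\<rfloor>)"
  have N: "real (N L) \<ge> L / 16" "real (N L) \<le> L" "N L \<ge> 2 * m"
    if "L \<ge> 20 + 16 * real m" for L
  proof -
    have "\<lfloor>(L - 2) / 8\<rfloor> \<ge> 0" using that by simp
    then have "real (N L) = of_int \<lfloor>(L - 2) / 8\<rfloor>" by (simp add: N_def)
    then have "real (N L) > (L - 2) / 8 - 1" "real (N L) \<le> (L - 2) / 8" by linarith+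
    then show lo: "real (N L) \<ge> L / 16" and "real (N L) \<le> L" using that by (simp_all add: field_simps)
    have "2 * real m \<le> real (N L)" using \<open>real (N L) > (L - 2) / 8 - 1\<close> that by argo
    then show "N L \<ge> 2 * m" by linarith
  qed
  consider "\<alpha> > 1" | "\<alpha> = 1" | "\<alpha> < 1" by linarith
  then show ?thesis
  proof cases
    case 1
    have "real m powr (- \<alpha>) * data_growth \<alpha> L \<le> (\<Sum>j=m..N L. real j powr (- \<alpha>))"
      if "L \<ge> 20 + 16 * real m" for L
      using N(3)[OF that] 1 member_le_sum[of m "{m..N L}" "\<lambda>j. real j powr (- \<alpha>)"]
      by (simp add: data_growth_def)
    then show ?thesis unfolding N_def using m
      by (intro exI[of _ "real m powr (- \<alpha>)"] conjI exI[of _ "20 + 16 * real m"]) auto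
  next
    case 2
    have "1 / 2 * data_growth \<alpha> L \<le> (\<Sum>j=m..N L. real j powr (- \<alpha>))"
      if L: "L \<ge> 20 + 16 * real m + (16 * real m)\<^sup>2" for L
    proof -
      have L': "L \<ge> 20 + 16 * real m" using L by (smt (verit) zero_le_power2)
      have Lpos: "L > 0" using L' by linarith
      have "16 * real m \<le> sqrt L" using L by (intro real_le_rsqrt) linarith
      then have "sqrt L * (16 * real m) \<le> sqrt L * sqrt L" using Lpos by (intro mult_left_mono) auto
      then have "sqrt L * (16 * real m) \<le> L" using Lpos by simp
      then have "sqrt L \<le> L / 16 / real m" using m by (simp add: field_simps)
      also have "\<dots> \<le> real (Suc (N L)) / real m"
        using N(1)[OF L'] m by (intro divide_right_mono) auto
      finally have "ln (sqrt L) \<le> ln (real (Suc (N L)) / real m)"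
        using Lpos m by (subst ln_le_cancel_iff) auto
      also have "\<dots> \<le> (\<Sum>j=m..N L. 1 / real j)"
        using m N(3)[OF L'] by (intro sum_inverse_ge_ln) auto
      also have "\<dots> = (\<Sum>j=m..N L. real j powr (- \<alpha>))"
        using 2 m by (intro sum.cong) (auto simp: powr_minus divide_inverse)
      finally show ?thesis using 2 Lpos by (simp add: data_growth_def ln_sqrt)
    qed
    then show ?thesis unfolding N_def
      by (intro exI[of _ "1 / 2"] conjI exI[of _ "20 + 16 * real m + (16 * real m)\<^sup>2"])
         (auto intro: add_increasing2)
  next
    case 3
    define \<kappa> where "\<kappa> = min 1 (2 powr \<alpha>)"
    have \<kappa>: "\<kappa> > 0" by (simp add: \<kappa>_def)
    have "\<kappa> / 2 * (1 / 16) powr (1 - \<alpha>) * data_growth \<alpha> L \<le> (\<Sum>j=m..N L. real j powr (- \<alpha>))"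
      if L: "L \<ge> 20 + 16 * real m" for L
    proof -
      \<comment> \<open>The upper half of the index range has all its terms comparable to the last one.\<close>
      define n where "n = N L div 2"
      have n: "m \<le> Suc n" "2 * n \<le> N L" "N L \<le> 2 * Suc n" "N L > 0"
        using N(3)[OF L] m by (auto simp: n_def)
      have "data_growth \<alpha> L * (1 / 16) powr (1 - \<alpha>) = (L / 16) powr (1 - \<alpha>)"
        using 3 L by (simp add: data_growth_def powr_divide)
      also have "\<dots> \<le> real (N L) powr (1 - \<alpha>)"
        using N(1)[OF L] L 3 by (intro powr_mono2) auto
      also have "\<dots> = real (N L) * real (N L) powr (- \<alpha>)"
        using n powr_add[of "real (N L)" 1 "- \<alpha>"] by simp
      finally have "\<kappa> / 2 * (data_growth \<alpha> L * (1 / 16) powr (1 - \<alpha>)) \<le>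
          \<kappa> / 2 * (real (N L) * real (N L) powr (- \<alpha>))"
        using \<kappa> by (intro mult_left_mono) auto
      also have "\<dots> = real (N L) / 2 * (\<kappa> * real (N L) powr (- \<alpha>))" by simp
      also have "\<dots> \<le> real (card {Suc n..N L}) * (\<kappa> * real (N L) powr (- \<alpha>))"
        using n \<kappa> by (intro mult_right_mono) auto
      also have "\<dots> \<le> (\<Sum>j=Suc n..N L. real j powr (- \<alpha>))"
        by (rule sum_bounded_below, unfold \<kappa>_def, rule powr_comparable) (use n in auto)
      also have "\<dots> \<le> (\<Sum>j=m..N L. real j powr (- \<alpha>))"
        using n by (intro sum_mono2) auto
      finally show ?thesis by (simp add: mult_ac)
    qed
    then show ?thesis unfolding N_def using \<kappa>
      by (intro exI[of _ "\<kappa> / 2 * (1 / 16) powr (1 - \<alpha>)"] conjI exI[of _ "20 + 16 * real m"]) auto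
  qed
qed

section \<open>Lifespan\<close>

text \<open>
  The order of magnitude of the largest \<open>L\<close> with \<open>\<epsilon> * data_growth \<alpha> L \<le> L powr (- (d / 2))\<close>.
\<close>

definition lifespan_exponent :: "real \<Rightarrow> real \<Rightarrow> real \<Rightarrow> real" where
  "lifespan_exponent d \<alpha> \<epsilon> =
    (if \<alpha> > 1 then \<epsilon> powr (- 2 / d)
     else if \<alpha> = 1 then (\<epsilon> * ln (inverse \<epsilon>)) powr (- 2 / d)
     else \<epsilon> powr (- 2 / (d + 2 * (1 - \<alpha>))))"

lemma mult_ln_inverse_bounds:
  fixes \<epsilon> :: real
  assumes "0 < \<epsilon>" "\<epsilon> < 1"
  shows "0 < \<epsilon> * ln (inverse \<epsilon>)" "\<epsilon> * ln (inverse \<epsilon>) \<le> \<epsilon> powr (1 / 2)"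
proof -
  show "0 < \<epsilon> * ln (inverse \<epsilon>)" using assms by (intro mult_pos_pos ln_gt_zero one_less_inverse)
  \<comment> \<open>With \<open>\<epsilon> = r ^ 4\<close> and \<open>ln y \<le> y - 1\<close> the claim becomes \<open>(2 * r - 1)\<^sup>2 \<ge> 0\<close>.\<close>
  define r where "r = \<epsilon> powr (1 / 4)"
  have r: "r > 0" using assms by (simp add: r_def)
  have e: "\<epsilon> = r ^ 4" "\<epsilon> powr (1 / 2) = r\<^sup>2"
    using assms by (simp_all add: r_def powr_powr flip: powr_realpow)
  have "ln (inverse \<epsilon>) = 4 * ln (inverse r)" using r by (simp add: e ln_inverse ln_realpow)
  also have "\<dots> \<le> 4 * (inverse r - 1)" using ln_le_minus_one[of "inverse r"] r by simp
  finally have "\<epsilon> * ln (inverse \<epsilon>) \<le> r ^ 4 * (4 * (inverse r - 1))"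
    unfolding e(1) using r by (intro mult_left_mono) auto
  also have "\<dots> = r\<^sup>2 * (1 - (2 * r - 1)\<^sup>2)"
    using r by (simp add: field_simps power2_eq_square power4_eq_xxxx)
  also have "\<dots> \<le> r\<^sup>2 * 1" by (intro mult_left_mono) auto
  finally show "\<epsilon> * ln (inverse \<epsilon>) \<le> \<epsilon> powr (1 / 2)" unfolding e(2) by simp
qed

lemma le_powr_of_powr_le:
  fixes a x y :: real
  assumes "a > 0" "x > 0" "x powr a \<le> y"
  shows "x \<le> y powr (1 / a)"
proof -
  have "x = (x powr a) powr (1 / a)" using assms by (simp add: powr_powr)
  also have "\<dots> \<le> y powr (1 / a)" using assms by (intro powr_mono2) auto
  finally show ?thesis .
qed

lemma lifespan_exponent_ge_one:
  assumes "d > 0" "0 < \<epsilon>" "\<epsilon> < 1"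
  shows "lifespan_exponent d \<alpha> \<epsilon> \<ge> 1"
proof -
  have *: "x powr (- 2 / a) \<ge> 1" if "0 < x" "x \<le> 1" "a > 0" for x a :: real
    using powr_mono2'[of "- 2 / a" x 1] that by simp
  have "\<epsilon> powr (1 / 2) \<le> 1" using assms by (intro powr_le1) auto
  then have "\<epsilon> * ln (inverse \<epsilon>) \<le> 1" using mult_ln_inverse_bounds[OF assms(2,3)] by linarith
  then show ?thesis
    unfolding lifespan_exponent_def using assms mult_ln_inverse_bounds[OF assms(2,3)]
    by (auto intro!: * simp del: minus_divide_left minus_divide_right divide_minus_left)
qed

text \<open>
  For \<open>\<alpha> \<noteq> 1\<close> the inequality is a pure power law in \<open>L\<close>. For \<open>\<alpha> = 1\<close> the logarithm is removed by a
  dichotomy: if \<open>L \<le> \<epsilon> powr (- 1 / d)\<close>, the bound holds because \<open>\<epsilon> * ln (1 / \<epsilon>) \<le> sqrt \<epsilon>\<close>; otherwise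
  \<open>ln L\<close> is at least \<open>ln (1 / \<epsilon>) / d\<close>, and a power law remains.
\<close>

lemma le_lifespan_exponent:
  fixes d K \<alpha> :: real
  assumes d: "d > 0" and K: "K > 0"
  shows "\<exists>C>0. \<forall>\<epsilon>\<in>{0<..<1}. \<forall>L\<ge>1. \<epsilon> * data_growth \<alpha> L \<le> K * L powr (- (d / 2)) \<longrightarrow>
    L \<le> C * lifespan_exponent d \<alpha> \<epsilon>"
proof -
  \<comment> \<open>The factor \<open>L powr (- (d / 2))\<close> cancels and leaves \<open>x * L powr a \<le> k\<close>.\<close>
  have solve: "L \<le> k powr (1 / a) * x powr (- 1 / a)"
    if "a > 0" "k > 0" "x > 0" "L \<ge> 1" "x * L powr (a - d / 2) \<le> k * L powr (- (d / 2))"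
    for a k x L :: real
  proof -
    have "L powr (a - d / 2) = L powr a * L powr (- (d / 2))"
      by (simp flip: powr_add)
    then have "(x * L powr a) * L powr (- (d / 2)) \<le> k * L powr (- (d / 2))"
      using that(5) by (simp add: mult.assoc)
    then have "x * L powr a \<le> k" using that(4) by (simp add: mult_le_cancel_right)
    then have "L powr a \<le> k / x" using that by (simp add: field_simps)
    then have "L \<le> (k / x) powr (1 / a)" using that by (intro le_powr_of_powr_le) auto
    also have "\<dots> = k powr (1 / a) * x powr (- 1 / a)"
      using that by (simp add: powr_divide powr_minus_divide)
    finally show ?thesis .
  qed
  consider "\<alpha> > 1" | "\<alpha> = 1" | "\<alpha> < 1" by linarith
  then show ?thesis
  proof cases
    case 1
    have "L \<le> K powr (2 / d) * lifespan_exponent d \<alpha> \<epsilon>"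
      if "0 < \<epsilon>" "L \<ge> 1" "\<epsilon> * data_growth \<alpha> L \<le> K * L powr (- (d / 2))" for \<epsilon> L
      using solve[of "d / 2" K \<epsilon> L] that d K 1 by (simp add: data_growth_def lifespan_exponent_def)
    then show ?thesis using K by (intro exI[of _ "K powr (2 / d)"]) auto
  next
    case 2
    have "L \<le> (1 + (K * d) powr (2 / d)) * lifespan_exponent d \<alpha> \<epsilon>"
      if \<epsilon>: "0 < \<epsilon>" "\<epsilon> < 1" and L: "L \<ge> 1" "\<epsilon> * data_growth \<alpha> L \<le> K * L powr (- (d / 2))" for \<epsilon> L
    proof -
      define x where "x = \<epsilon> * ln (inverse \<epsilon>)"
      have x: "0 < x" "x \<le> \<epsilon> powr (1 / 2)"
        unfolding x_def by (rule mult_ln_inverse_bounds[OF \<epsilon>])+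
      have "L \<le> x powr (- 2 / d) \<or> L \<le> (K * d) powr (2 / d) * x powr (- 2 / d)"
      proof (cases "L \<le> \<epsilon> powr (- 1 / d)")
        case True
        also have "\<epsilon> powr (- 1 / d) = (\<epsilon> powr (1 / 2)) powr (- 2 / d)"
          by (simp add: powr_powr)
        also have "\<dots> \<le> x powr (- 2 / d)"
          using x d by (intro powr_mono2') auto
        finally show ?thesis by simp
      next
        case False
        then have "ln (\<epsilon> powr (- 1 / d)) \<le> ln L"
          using \<epsilon> L by (subst ln_le_cancel_iff) auto
        then have "ln (inverse \<epsilon>) \<le> d * ln L"
          using \<epsilon> d by (simp add: ln_inverse) (simp add: field_simps)
        then have "x \<le> d * (\<epsilon> * ln L)"
          unfolding x_def using mult_left_mono[of "ln (inverse \<epsilon>)" "d * ln L" \<epsilon>] \<epsilon> by (simp add: mult_ac)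
        also have "\<dots> \<le> d * (K * L powr (- (d / 2)))"
          using L 2 d by (intro mult_left_mono) (auto simp: data_growth_def)
        finally show ?thesis using solve[of "d / 2" "K * d" x L] x L K d by (simp add: mult_ac)
      qed
      then have "L \<le> x powr (- 2 / d) + (K * d) powr (2 / d) * x powr (- 2 / d)"
        by (smt (verit) mult_nonneg_nonneg powr_ge_zero)
      then show ?thesis using 2 by (simp add: lifespan_exponent_def x_def algebra_simps)
    qed
    then show ?thesis
      by (intro exI[of _ "1 + (K * d) powr (2 / d)"] conjI) (auto intro: add_pos_nonneg)
  next
    case 3
    define a where "a = d / 2 + (1 - \<alpha>)"
    have a: "a > 0" "- 1 / a = - 2 / (d + 2 * (1 - \<alpha>))" using d 3 by (auto simp: a_def field_simps)
    have "L \<le> K powr (1 / a) * lifespan_exponent d \<alpha> \<epsilon>"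
      if "0 < \<epsilon>" "L \<ge> 1" "\<epsilon> * data_growth \<alpha> L \<le> K * L powr (- (d / 2))" for \<epsilon> L
    proof -
      have "a - d / 2 = 1 - \<alpha>" by (simp add: a_def)
      then show ?thesis
        using solve[of a K \<epsilon> L] that K 3 a by (simp add: data_growth_def lifespan_exponent_def)
    qed
    then show ?thesis using K by (intro exI[of _ "K powr (1 / a)"]) auto
  qed
qed

theorem theorem2p4:
  fixes \<alpha> R0 \<mu> :: real
  assumes "R0 > 0" and "\<mu> > 0"
  shows "\<exists>C>0. \<forall>(g :: int \<Rightarrow> complex) (f :: 'a::euclidean_space \<Rightarrow> complex).
    (\<lambda>n. norm (g n)) summable_on UNIV \<longrightarrow>
    g 0 = 1 \<longrightarrow>
    \<mu> = Re (g 0) - (\<Sum>\<^sub>\<infinity>n\<in>-{0}. norm (g n)) \<longrightarrow>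
    Lp_loc 1 UNIV f \<longrightarrow>
    (AE x in lebesgue. - Im (f x) \<ge>
       (if norm x > R0 then norm x powr (- real DIM('a)) * ln (norm x) powr (- \<alpha>) else 0)) \<longrightarrow>
    (\<exists>\<epsilon>0>0. \<forall>\<epsilon>\<in>{0<..<\<epsilon>0}.
       T_max (homogeneous_nonlinearity (1 + 2 / real DIM('a)) g) (\<lambda>x. complex_of_real \<epsilon> * f x) \<le>
       ennreal (
         if \<alpha> > 1 then exp (C * \<epsilon> powr (- 2 / real DIM('a)))
         else if \<alpha> = 1 then exp (C * (\<epsilon> * ln (inverse \<epsilon>)) powr (- 2 / real DIM('a)))
         else exp (C * \<epsilon> powr (- 2 / (real DIM('a) + 2 * (1 - \<alpha>))))))"
proof -
  define d where "d = real DIM('a)"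
  have d: "d > 0" by (simp add: d_def)
  \<comment> \<open>The first shell that counts: it lies outside the ball of radius \<open>R0\<close>, and \<open>m \<ge> 2\<close> makes
      \<open>j - 1 \<ge> j / 2\<close>, as needed to compare \<open>ln (norm x)\<close> with \<open>j\<close>.\<close>
  define m where "m = nat \<lceil>R0\<rceil> + 2"
  have m: "m \<ge> 2" "exp (real m - 1) > R0"
  proof -
    have "R0 < real m - 1 + 1" by (simp add: m_def) linarith
    also have "\<dots> \<le> exp (real m - 1)" by (subst add.commute) (rule exp_ge_add_one_self)
    finally show "exp (real m - 1) > R0" .
  qed (simp add: m_def)
  obtain c L0 where c: "c > 0" and L0: "L0 \<ge> 1" and growth: "\<And>L. L \<ge> L0 \<Longrightarrow>
      c * data_growth \<alpha> L \<le> (\<Sum>j=m..nat \<lfloor>(L - 2) / 8\<rfloor>. real j powr (- \<alpha>))"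
    using sum_powr_ge_data_growth[of m \<alpha>] m by auto
  define \<gamma> where "\<gamma> = exp (-2) * min 1 (2 powr \<alpha>) * unit_ball_vol d * (1 - exp (-1))"
  have \<gamma>: "\<gamma> > 0" unfolding \<gamma>_def using d by (intro mult_pos_pos unit_ball_vol_pos) auto
  obtain K where K: "K > 0" and weak: "\<And>F (u0 :: 'a \<Rightarrow> complex) T u L.
    (\<And>w. \<mu> * norm w powr (1 + 2 / d) \<le> Re (F w)) \<Longrightarrow>
    weak_solution F u0 T u \<Longrightarrow> L \<ge> 1 \<Longrightarrow> exp (L / 2) \<le> T \<Longrightarrow>
    Re (\<i> * (LINT x|lebesgue. u0 x * complex_of_real (log_cutoff L (0, x)))) \<le> K * L powr (- (d / 2))"
    using weak_solution_data_bound[OF \<open>\<mu> > 0\<close>, where 'a='a] unfolding d_def by blast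
  obtain C where C: "C > 0" and exponent: "\<And>\<epsilon> L. 0 < \<epsilon> \<Longrightarrow> \<epsilon> < 1 \<Longrightarrow> L \<ge> 1 \<Longrightarrow>
      \<epsilon> * data_growth \<alpha> L \<le> K / (\<gamma> * c) * L powr (- (d / 2)) \<Longrightarrow> L \<le> C * lifespan_exponent d \<alpha> \<epsilon>"
    using le_lifespan_exponent[of d "K / (\<gamma> * c)" \<alpha>] d K \<gamma> c by (auto simp: Ball_def)
  \<comment> \<open>The asymptotic estimates hold from \<open>L1\<close> on. Shorter lifespans are covered by adding \<open>L1\<close> to the
      constant, because the lifespan exponent is at least \<open>1\<close> for \<open>\<epsilon> < 1\<close>; this allows \<open>\<epsilon>0 = 1\<close>.\<close>
  define L1 where "L1 = L0 + 10"
  have lifespan: "T \<le> exp ((C + L1) * lifespan_exponent d \<alpha> \<epsilon>)"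
    if F: "\<And>w. \<mu> * norm w powr (1 + 2 / d) \<le> Re (F w)"
      and f: "Lp_loc 1 UNIV f"
      and lower: "AE x in lebesgue. - Im (f x) \<ge>
        (if norm x > R0 then norm x powr (- real DIM('a)) * ln (norm x) powr (- \<alpha>) else 0)"
      and \<epsilon>: "0 < \<epsilon>" "\<epsilon> < 1" and T: "T > 0"
      and u: "weak_solution F (\<lambda>x. complex_of_real \<epsilon> * f x) T u"
    for F and f :: "'a \<Rightarrow> complex" and \<epsilon> T u
  proof -
    define L where "L = 2 * ln T"
    have TL: "exp (L / 2) = T" using T by (simp add: L_def)
    have e1: "lifespan_exponent d \<alpha> \<epsilon> \<ge> 1" using d \<epsilon> by (rule lifespan_exponent_ge_one)
    have "L \<le> (C + L1) * lifespan_exponent d \<alpha> \<epsilon>"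
    proof (cases "L \<le> L1")
      case True
      then have "L \<le> L1 * 1" by simp
      also have "\<dots> \<le> (C + L1) * lifespan_exponent d \<alpha> \<epsilon>"
        using e1 C L0 by (intro mult_mono) (auto simp: L1_def)
      finally show ?thesis .
    next
      case False
      then have L: "L \<ge> L0" "L \<ge> 1" "L \<ge> 10" using L0 by (auto simp: L1_def)
      define I where "I = (LINT x|lebesgue. f x * complex_of_real (log_cutoff L (0, x)))"
      have "4 * real (nat \<lfloor>(L - 2) / 8\<rfloor>) + 1 \<le> L / 2"
      proof -
        have "real (nat \<lfloor>(L - 2) / 8\<rfloor>) \<le> (L - 2) / 8" using L by (intro of_nat_floor) simp
        then show ?thesis by simp
      qed
      from data_integral_ge_sum[OF f _ this m lower] L
      have "\<gamma> * (\<Sum>j=m..nat \<lfloor>(L - 2) / 8\<rfloor>. real j powr (- \<alpha>)) \<le> - Im I"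
        by (simp add: I_def \<gamma>_def d_def)
      moreover have "\<gamma> * (c * data_growth \<alpha> L) \<le> \<gamma> * (\<Sum>j=m..nat \<lfloor>(L - 2) / 8\<rfloor>. real j powr (- \<alpha>))"
        using growth[OF L(1)] \<gamma> by (intro mult_left_mono) auto
      ultimately have "\<gamma> * (c * data_growth \<alpha> L) \<le> - Im I" by linarith
      then have "\<epsilon> * (\<gamma> * (c * data_growth \<alpha> L)) \<le> \<epsilon> * - Im I"
        using \<epsilon> by (intro mult_left_mono) auto
      also have "\<dots> = Re (\<i> * (LINT x|lebesgue.
          complex_of_real \<epsilon> * f x * complex_of_real (log_cutoff L (0, x))))"
        by (simp add: I_def mult.assoc)
      also have "\<dots> \<le> K * L powr (- (d / 2))"
        using weak[OF F u L(2)] TL by simp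
      finally have "\<epsilon> * data_growth \<alpha> L \<le> K / (\<gamma> * c) * L powr (- (d / 2))"
        using \<gamma> c by (simp add: field_simps)
      then have "L \<le> C * lifespan_exponent d \<alpha> \<epsilon>" by (rule exponent[OF \<epsilon> L(2)])
      also have "\<dots> \<le> (C + L1) * lifespan_exponent d \<alpha> \<epsilon>"
        using e1 L0 by (intro mult_right_mono) (auto simp: L1_def)
      finally show ?thesis .
    qed
    moreover have "0 \<le> (C + L1) * lifespan_exponent d \<alpha> \<epsilon>"
      using e1 C L0 by (simp add: L1_def)
    ultimately have "L / 2 \<le> (C + L1) * lifespan_exponent d \<alpha> \<epsilon>" by linarith
    then show ?thesis using TL by (metis exp_le_cancel_iff)
  qed
  have rate: "(if \<alpha> > 1 then exp (B * \<epsilon> powr (- 2 / real DIM('a)))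
         else if \<alpha> = 1 then exp (B * (\<epsilon> * ln (inverse \<epsilon>)) powr (- 2 / real DIM('a)))
         else exp (B * \<epsilon> powr (- 2 / (real DIM('a) + 2 * (1 - \<alpha>))))) =
      exp (B * lifespan_exponent d \<alpha> \<epsilon>)" for B \<epsilon>
    by (simp add: lifespan_exponent_def d_def)
  have T_max: "T_max (homogeneous_nonlinearity (1 + 2 / real DIM('a)) g) (\<lambda>x. complex_of_real \<epsilon> * f x)
      \<le> ennreal (exp ((C + L1) * lifespan_exponent d \<alpha> \<epsilon>))"
    if g: "(\<lambda>n. norm (g n)) summable_on UNIV" "g 0 = 1"
        "\<mu> = Re (g 0) - (\<Sum>\<^sub>\<infinity>n\<in>-{0}. norm (g n))"
      and f: "Lp_loc 1 UNIV f"
      and lower: "AE x in lebesgue. - Im (f x) \<ge>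
        (if norm x > R0 then norm x powr (- real DIM('a)) * ln (norm x) powr (- \<alpha>) else 0)"
      and \<epsilon>: "\<epsilon> \<in> {0<..<1}"
    for g and f :: "'a \<Rightarrow> complex" and \<epsilon>
    unfolding T_max_def
  proof (rule Sup_least)
    fix t
    assume "t \<in> {ennreal T |T. 0 < T \<and> (\<exists>u. weak_solution
        (homogeneous_nonlinearity (1 + 2 / real DIM('a)) g) (\<lambda>x. complex_of_real \<epsilon> * f x) T u)}"
    then obtain T u where T: "t = ennreal T" "0 < T" "weak_solution
        (homogeneous_nonlinearity (1 + 2 / real DIM('a)) g) (\<lambda>x. complex_of_real \<epsilon> * f x) T u"
      by blast
    have "T \<le> exp ((C + L1) * lifespan_exponent d \<alpha> \<epsilon>)"
      using lifespan[OF _ f lower _ _ T(2,3)] Re_homogeneous_nonlinearity_ge[OF g(1,2)] g(3) \<epsilon>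
      by (simp add: d_def)
    then show "t \<le> ennreal (exp ((C + L1) * lifespan_exponent d \<alpha> \<epsilon>))"
      by (simp add: T(1) ennreal_leI)
  qed
  have "C + L1 > 0" using C L0 by (simp add: L1_def)
  moreover have "(0::real) < 1" by simp
  ultimately show ?thesis
    unfolding rate using T_max by blast
qed

end
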